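(* Let $0<\alpha<n$, $0\leq\lambda<n$, $1<p<(n-\lambda)/\alpha$ and $\frac1q=\frac1p-\frac{\alpha}{n-\lambda}$. Let $T^\alpha$ be any of the operators $I^\alpha$, $M^\alpha$, $H^\alpha$, $\mathcal{H}^\alpha$. Then $T^\alpha$ is bounded from $V_{0,\infty}^{(\ast)}L^{p,\lambda}(\mathbb{R}^n)$ into $V_{0,\infty}^{(\ast)}L^{q,\lambda}(\mathbb{R}^n)$; that is, $T^\alpha f\in V_{0,\infty}^{(\ast)}L^{q,\lambda}(\mathbb{R}^n)$ for every $f\in V_{0,\infty}^{(\ast)}L^{p,\lambda}(\mathbb{R}^n)$, and $\|T^\alpha f\|_{q,\lambda}\leq C\|f\|_{p,\lambda}$ with $C$ independent of $f$.
   Context: For $1\le p<\infty$, $0\le\lambda\le n$, $x\in\mathbb{R}^n$, $r>0$, let $B(x,r)$ be the open ball and $\mathfrak{M}_{p,\lambda}(f;x,r):=\frac{1}{r^\lambda}\int_{B(x,r)}|f(y)|^p\,dy$. The Morrey space $L^{p,\lambda}(\mathbb{R}^n)$ consists of all locally $p$-integrable $f$ on $\mathbb{R}^n$ with $\|f\|_{p,\lambda}:=\sup_{x\in\mathbb{R}^n,\,r>0}\mathfrak{M}_{p,\lambda}(f;x,r)^{1/p}<\infty$. The subspace $V_{0,\infty}^{(\ast)}L^{p,\lambda}(\mathbb{R}^n)$ consists of all $f\in L^{p,\lambda}(\mathbb{R}^n)$ satisfying all three of the properties: - $(V_0)$: $\lim_{r\to0}\sup_{x\in\mathbb{R}^n}\mathfrak{M}_{p,\lambda}(f;x,r)=0$;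 - $(V_\infty)$: $\lim_{r\to\infty}\sup_{x\in\mathbb{R}^n}\mathfrak{M}_{p,\lambda}(f;x,r)=0$; - $(V^\ast)$: $\lim_{N\to\infty}\sup_{x\in\mathbb{R}^n}\int_{B(x,1)}|f(y)|^p\,\chi_{\mathbb{R}^n\setminus B(0,N)}(y)\,dy=0$. Operators, for $0<\alpha<n$: - Riesz potential $I^\alpha f(x):=\int_{\mathbb{R}^n}\frac{f(y)}{|x-y|^{n-\alpha}}\,dy$; - fractional maximal operator $M^\alpha f(x):=\sup_{t>0}\frac{1}{|B(x,t)|^{1-\alpha/n}}\int_{B(x,t)}|f(y)|\,dy$; - Hardy type operators $H^\alpha f(x):=|x|^{\alpha-n}\int_{|y|<|x|}f(y)\,dy$ and $\mathcal{H}^\alpha f(x):=|x|^\alpha\int_{|y|>|x|}\frac{f(y)}{|y|^n}\,dy$. *)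

theory Defs
  imports "HOL-Analysis.Analysis"
begin

text \<open>
  Functions on \<open>\<real>\<^sup>n\<close> are rendered as \<open>f :: real ^ 'n \<Rightarrow> 'b\<close> with \<open>n = CARD('n)\<close>.
  For the operators, \<open>'b\<close> is a field of scalars (in particular the reals or the complex numbers).
  Measurability and integrals refer to the (completed) Lebesgue measure.
\<close>

definition locally_p_integrable :: "real \<Rightarrow> (real ^ 'n \<Rightarrow> 'b::real_normed_vector) \<Rightarrow> bool" where
  "locally_p_integrable p f \<longleftrightarrow>
     f \<in> borel_measurable lebesgue \<and>
     (\<forall>K. compact K \<longrightarrow> set_integrable lebesgue K (\<lambda>y. norm (f y) powr p))"

definition morrey_modular ::
    "real \<Rightarrow> real \<Rightarrow> (real ^ 'n \<Rightarrow> 'b::real_normed_vector) \<Rightarrow> real ^ 'n \<Rightarrow> real \<Rightarrow> real" where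
  "morrey_modular p l f x r =
     1 / r powr l * (LINT y:ball x r|lebesgue. norm (f y) powr p)"

text \<open>The suprema below are taken in the reals. Membership in the Morrey space
  makes all of them suprema of bounded sets.\<close>

definition morrey_space :: "real \<Rightarrow> real \<Rightarrow> (real ^ 'n \<Rightarrow> 'b::real_normed_vector) set" where
  "morrey_space p l =
     {f. locally_p_integrable p f \<and>
         bdd_above ((\<lambda>(x, r). morrey_modular p l f x r powr (1 / p)) ` (UNIV \<times> {0<..}))}"

definition morrey_norm :: "real \<Rightarrow> real \<Rightarrow> (real ^ 'n \<Rightarrow> 'b::real_normed_vector) \<Rightarrow> real" where
  "morrey_norm p l f =
     (SUP (x, r) \<in> UNIV \<times> {0<..}. morrey_modular p l f x r powr (1 / p))"

definition vanishing_at_0 :: "real \<Rightarrow> real \<Rightarrow> (real ^ 'n \<Rightarrow> 'b::real_normed_vector) \<Rightarrow> bool" where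
  "vanishing_at_0 p l f \<longleftrightarrow>
     ((\<lambda>r. SUP x. morrey_modular p l f x r) \<longlongrightarrow> 0) (at_right 0)"

definition vanishing_at_infinity :: "real \<Rightarrow> real \<Rightarrow> (real ^ 'n \<Rightarrow> 'b::real_normed_vector) \<Rightarrow> bool" where
  "vanishing_at_infinity p l f \<longleftrightarrow>
     ((\<lambda>r. SUP x. morrey_modular p l f x r) \<longlongrightarrow> 0) at_top"

definition vanishing_star :: "real \<Rightarrow> (real ^ 'n \<Rightarrow> 'b::real_normed_vector) \<Rightarrow> bool" where
  "vanishing_star p f \<longleftrightarrow>
     ((\<lambda>N::real. SUP x. LINT y:ball x 1|lebesgue.
         norm (f y) powr p * indicat_real (- ball 0 N) y) \<longlongrightarrow> 0) at_top"

definition vanishing_morrey_space ::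
    "real \<Rightarrow> real \<Rightarrow> (real ^ 'n \<Rightarrow> 'b::real_normed_vector) set" where
  "vanishing_morrey_space p l =
     {f \<in> morrey_space p l.
        vanishing_at_0 p l f \<and> vanishing_at_infinity p l f \<and> vanishing_star p f}"

text \<open>
  On the Morrey spaces the operators are in general well defined only almost everywhere.
  Since the Bochner integral is total (it is 0 for non-integrable functions), every operator
  comes with the predicate saying that its defining expression is meaningful at \<open>x\<close>.
\<close>

definition riesz_potential ::
    "real \<Rightarrow> (real ^ 'n \<Rightarrow> 'b) \<Rightarrow> real ^ 'n \<Rightarrow> 'b::{real_normed_field, banach, second_countable_topology}" where
  "riesz_potential \<alpha> f x =
     (LINT y|lebesgue. f y /\<^sub>R norm (x - y) powr (real CARD('n) - \<alpha>))"

definition riesz_potential_defined ::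
    "real \<Rightarrow> (real ^ 'n \<Rightarrow> 'b::{real_normed_field, banach, second_countable_topology}) \<Rightarrow> real ^ 'n \<Rightarrow> bool" where
  "riesz_potential_defined \<alpha> f x \<longleftrightarrow>
     integrable lebesgue (\<lambda>y. f y /\<^sub>R norm (x - y) powr (real CARD('n) - \<alpha>))"

definition frac_maximal_ennreal ::
    "real \<Rightarrow> (real ^ 'n \<Rightarrow> 'b::real_normed_vector) \<Rightarrow> real ^ 'n \<Rightarrow> ennreal" where
  "frac_maximal_ennreal \<alpha> f x =
     (SUP t \<in> {0<..}.
        (\<integral>\<^sup>+ y \<in> ball x t. ennreal (norm (f y)) \<partial>lebesgue) /
        ennreal (measure lebesgue (ball x t) powr (1 - \<alpha> / real CARD('n))))"

definition frac_maximal ::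
    "real \<Rightarrow> (real ^ 'n \<Rightarrow> 'b) \<Rightarrow> real ^ 'n \<Rightarrow> 'b::{real_normed_field, banach, second_countable_topology}" where
  "frac_maximal \<alpha> f x = of_real (enn2real (frac_maximal_ennreal \<alpha> f x))"

definition frac_maximal_defined ::
    "real \<Rightarrow> (real ^ 'n \<Rightarrow> 'b::{real_normed_field, banach, second_countable_topology}) \<Rightarrow> real ^ 'n \<Rightarrow> bool" where
  "frac_maximal_defined \<alpha> f x \<longleftrightarrow> frac_maximal_ennreal \<alpha> f x < \<infinity>"

definition hardy_inner ::
    "real \<Rightarrow> (real ^ 'n \<Rightarrow> 'b) \<Rightarrow> real ^ 'n \<Rightarrow> 'b::{real_normed_field, banach, second_countable_topology}" where
  "hardy_inner \<alpha> f x =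
     norm x powr (\<alpha> - real CARD('n)) *\<^sub>R (LINT y:{y. norm y < norm x}|lebesgue. f y)"

definition hardy_inner_defined ::
    "real \<Rightarrow> (real ^ 'n \<Rightarrow> 'b::{real_normed_field, banach, second_countable_topology}) \<Rightarrow> real ^ 'n \<Rightarrow> bool" where
  "hardy_inner_defined \<alpha> f x \<longleftrightarrow> set_integrable lebesgue {y. norm y < norm x} f"

definition hardy_outer ::
    "real \<Rightarrow> (real ^ 'n \<Rightarrow> 'b) \<Rightarrow> real ^ 'n \<Rightarrow> 'b::{real_normed_field, banach, second_countable_topology}" where
  "hardy_outer \<alpha> f x =
     norm x powr \<alpha> *\<^sub>R (LINT y:{y. norm y > norm x}|lebesgue. f y /\<^sub>R norm y ^ CARD('n))"

definition hardy_outer_defined ::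
    "real \<Rightarrow> (real ^ 'n \<Rightarrow> 'b::{real_normed_field, banach, second_countable_topology}) \<Rightarrow> real ^ 'n \<Rightarrow> bool" where
  "hardy_outer_defined \<alpha> f x \<longleftrightarrow>
     set_integrable lebesgue {y. norm y > norm x} (\<lambda>y. f y /\<^sub>R norm y ^ CARD('n))"

end

theory Submission
  imports Defs
begin

text \<open>
  All four operators are dominated pointwise by a multiple of the Riesz potential of \<open>|f|\<close>, so only
  that potential, \<open>I f\<close>, has to be estimated. Writing its kernel \<open>|z|^(\<alpha> - n)\<close> as
  \<open>n - \<alpha>\<close> times the integral of \<open>t^(\<alpha> - n - 1)\<close> over \<open>t > |z|\<close> turns it into an average over \<open>t\<close> of the
  masses of \<open>|f|\<close> on \<open>B(x,t)\<close>. Bounding these by the maximal function \<open>M f\<close> for small \<open>t\<close> and by the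
  Morrey norm for large \<open>t\<close> gives Hedberg's inequality
  \<open>(I f)^q \<le> C \<parallel>f\<parallel>^(q - p) (M f)^p\<close>, which reduces everything to the maximal function.

  All the claims come from one local estimate: if \<open>|f|^p\<close> has mass at most \<open>\<sigma> t^n\<close> on \<open>B(y,t)\<close> for all
  \<open>y \<in> B(x,r)\<close> and \<open>t \<ge> r\<close>, then \<open>(M f)^p\<close> has mass at most \<open>C \<sigma> r^n\<close> on \<open>B(x,r)\<close>. The choice
  \<open>\<sigma> = \<parallel>f\<parallel>^p r^(\<lambda> - n)\<close> yields the norm bound, and each vanishing property of \<open>f\<close> allows a much
  smaller \<open>\<sigma>\<close> in the corresponding regime.
\<close>

section \<open>Masses of balls and the maximal function\<close>

text \<open>The condition \<open>p < (n - l) / \<alpha>\<close> makes the far part of the t-integral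
  converge: the Morrey bound gives \<open>|f|\<close> a mass of order
  \<open>t powr (n - (n - l) / p)\<close> on balls of radius t, so the integrand decays like
  \<open>t powr (- \<beta> - 1)\<close> with \<open>\<beta> = (n - l) / p - \<alpha> > 0\<close>.
  The relation for q is exactly the one for which the best splitting radius produces the powers p /
  q and 1 - p / q. The obstacle is that f need not be globally p-integrable, so the maximal theorem
  can only be applied to f cut off to B(x,2r). Averages over radii at least r are bounded pointwise
  instead, which is why the local estimate asks for mass bounds at such radii. Because
  \<open>l < n\<close>, the density \<open>t powr (l - n)\<close> of a Morrey bound decreases in t,
  so large radii are harmless, and this is the source of all gains in the vanishing claims: the
  Morrey norm enters through the power q - p, the density \<sigma> linearly. Masses, maximal
  function and potential take values in \<open>ennreal\<close>, so finiteness of the potential is a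
  conclusion, reached almost everywhere.\<close>

lemma sigma_finite_lebesgue: "sigma_finite_measure (lebesgue :: 'a::euclidean_space measure)"
proof
  obtain A :: "'a set set" where A: "countable A" "A \<subseteq> sets lborel" "\<Union>A = space lborel"
      "\<forall>a\<in>A. emeasure lborel a \<noteq> \<infinity>"
    using lborel.sigma_finite_countable by metis
  show "\<exists>A. countable A \<and> A \<subseteq> sets lebesgue \<and> \<Union>A = space (lebesgue :: 'a measure) \<and>
      (\<forall>a\<in>A. emeasure lebesgue a \<noteq> \<infinity>)"
    using A by (intro exI[of _ A]) (auto simp: subset_eq)
qed

interpretation lebesgue: sigma_finite_measure lebesgue
  by (rule sigma_finite_lebesgue)

text \<open>Tonelli is applied with the space variable under \<open>lebesgue\<close> and a level or
  a radius under \<open>lborel\<close>.\<close>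

interpretation lebesgue_lborel: pair_sigma_finite lebesgue lborel ..

lemma unit_ball_vol_DIM_neq_0 [simp]: "unit_ball_vol (real DIM('a::euclidean_space)) \<noteq> 0"
  using unit_ball_vol_pos[of "real DIM('a)"] by linarith

lemma ball_in_sets_lebesgue [measurable]: "ball (x::'a::euclidean_space) r \<in> sets lebesgue"
  by simp

definition ball_mass :: "('a::euclidean_space \<Rightarrow> real) \<Rightarrow> 'a \<Rightarrow> real \<Rightarrow> ennreal" where
  "ball_mass u x t = (\<integral>\<^sup>+ y\<in>ball x t. ennreal (u y) \<partial>lebesgue)"

text \<open>The centred Hardy-Littlewood maximal function, normalised by \<open>t ^ DIM('a)\<close>
  in place of the volume of the ball. It is \<open>unit_ball_vol\<close> times the usual one, which
  is why truncation heights later carry that factor.\<close>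

definition maximal_function :: "('a::euclidean_space \<Rightarrow> real) \<Rightarrow> 'a \<Rightarrow> ennreal" where
  "maximal_function u x = (SUP t\<in>{0<..}. ball_mass u x t / ennreal (t ^ DIM('a)))"

lemma ball_mass_eq_emeasure:
  assumes [measurable]: "u \<in> borel_measurable lebesgue"
  shows "ball_mass u x t = emeasure (density lebesgue (\<lambda>y. ennreal (u y))) (ball x t)"
  by (simp add: ball_mass_def emeasure_density)

lemma ball_mass_mono:
  assumes "ball x s \<subseteq> ball y t"
  shows "ball_mass u x s \<le> ball_mass u y t"
  unfolding ball_mass_def using assms
  by (intro nn_integral_mono) (auto simp: indicator_def)

lemma ball_mass_mono_fun:
  assumes "\<And>y. y \<in> ball x t \<Longrightarrow> u y \<le> v y"
  shows "ball_mass u x t \<le> ball_mass v x t"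
  unfolding ball_mass_def using assms
  by (intro nn_integral_mono) (auto simp: indicator_def intro: ennreal_leI)

text \<open>By continuity from below, some ball of radius \<open>t - 1 / Suc i\<close> about
  \<open>x\<close> already has mass above \<open>s\<close>, and it is contained in
  \<open>ball y t\<close> once \<open>y\<close> is within \<open>1 / Suc i\<close> of
  \<open>x\<close>.\<close>

lemma ball_mass_lower_semicontinuous:
  assumes [measurable]: "u \<in> borel_measurable lebesgue" and s: "s < ball_mass u x t"
  shows "\<exists>d>0. \<forall>y\<in>ball x d. s < ball_mass u y t"
proof -
  let ?M = "density lebesgue (\<lambda>y. ennreal (u y))"
  let ?A = "\<lambda>i::nat. ball x (t - 1 / Suc i)"
  have inc: "incseq ?A"
  proof (rule monoI, rule subset_ball)
    fix m n :: nat assume "m \<le> n"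
    then have "1 / real (Suc n) \<le> 1 / real (Suc m)" by (simp add: frac_le)
    then show "t - 1 / real (Suc m) \<le> t - 1 / real (Suc n)" by simp
  qed
  have un: "(\<Union>i. ?A i) = ball x t"
  proof (intro equalityI subsetI)
    fix y assume "y \<in> ball x t"
    then have "0 < t - dist x y" by simp
    then obtain i where "inverse (real (Suc i)) < t - dist x y"
      using reals_Archimedean by blast
    then have "y \<in> ?A i" by (simp add: field_simps)
    then show "y \<in> (\<Union>i. ?A i)" by blast
  next
    fix y assume "y \<in> (\<Union>i. ?A i)"
    then obtain i where "dist x y < t - 1 / real (Suc i)" by auto
    moreover have "0 < 1 / real (Suc i)" by simp
    ultimately have "dist x y < t" by linarith
    then show "y \<in> ball x t" by simp
  qed
  have "(SUP i. emeasure ?M (?A i)) = emeasure ?M (\<Union>i. ?A i)"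
    by (rule SUP_emeasure_incseq) (use inc in auto)
  then have "s < (SUP i. emeasure ?M (?A i))"
    using s unfolding un by (simp add: ball_mass_eq_emeasure)
  then obtain i where i: "s < emeasure ?M (?A i)"
    by (auto simp: less_SUP_iff)
  show ?thesis
  proof (intro exI[of _ "1 / real (Suc i)"] conjI ballI)
    fix y assume "y \<in> ball x (1 / real (Suc i))"
    then have "ball_mass u x (t - 1 / Suc i) \<le> ball_mass u y t"
      by (intro ball_mass_mono ball_subset_ball_iff[THEN iffD2]) (auto simp: dist_commute)
    then show "s < ball_mass u y t"
      using i by (simp add: ball_mass_eq_emeasure less_le_trans)
  qed simp
qed

section \<open>Measurability and the weak type inequality of the maximal function\<close>

lemma ennreal_less_divide_iff:
  fixes s a :: ennreal
  assumes "0 < c"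
  shows "s < a / ennreal c \<longleftrightarrow> s * ennreal c < a"
  using assms
  by (cases a; cases s)
     (auto simp: divide_ennreal ennreal_mult[symmetric] ennreal_less_iff field_simps
         ennreal_top_mult
        ennreal_top_divide ennreal_mult_less_top)

text \<open>Vitali's covering lemma yields a countable set of centres rather than a sequence, so
  subadditivity is phrased with an integral over \<open>count_space I\<close>, the form in which the
  disjoint balls are summed as well.\<close>

lemma emeasure_UN_le_nn_integral_count_space:
  assumes "countable I" and [measurable]: "\<And>i. i \<in> I \<Longrightarrow> X i \<in> sets M"
  shows "emeasure M (\<Union>i\<in>I. X i) \<le> (\<integral>\<^sup>+i. emeasure M (X i) \<partial>count_space I)"
proof -
  have [measurable]: "(\<Union>i\<in>I. X i) \<in> sets M"
    using assms by (intro sets.countable_UN'') auto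
  have "emeasure M (\<Union>i\<in>I. X i) = (\<integral>\<^sup>+x. indicator (\<Union>i\<in>I. X i) x \<partial>M)"
    by simp
  also have "\<dots> \<le> (\<integral>\<^sup>+x. \<integral>\<^sup>+i. indicator (X i) x \<partial>count_space I \<partial>M)"
  proof (rule nn_integral_mono)
    fix x
    show "indicator (\<Union>i\<in>I. X i) x \<le> (\<integral>\<^sup>+i. indicator (X i) x \<partial>count_space I :: ennreal)"
    proof (cases "x \<in> (\<Union>i\<in>I. X i)")
      case True
      then obtain i where i: "i \<in> I" "x \<in> X i" by blast
      show ?thesis
        using nn_integral_ge_point[OF i(1), of "\<lambda>i. indicator (X i) x"] i True by simp
    qed simp
  qed
  also have "\<dots> = (\<integral>\<^sup>+i. emeasure M (X i) \<partial>count_space I)"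
    using assms(1)
    by (subst nn_integral_count_space_nn_integral) (auto intro!: nn_integral_cong)
  finally show ?thesis .
qed

text \<open>A strict lower bound for the supremum is witnessed by one radius, and for this radius it
  persists nearby. The weight \<open>w\<close> is general so that the fractional maximal operator is
  covered too.\<close>

lemma open_SUP_ball_mass:
  assumes "u \<in> borel_measurable lebesgue" and "\<And>t. 0 < t \<Longrightarrow> 0 < w t"
  shows "open {x. s < (SUP t\<in>{0<..}. ball_mass u x t / ennreal (w t))}"
  unfolding open_contains_ball
proof safe
  fix x assume "s < (SUP t\<in>{0<..}. ball_mass u x t / ennreal (w t))"
  then obtain t where t: "0 < t" "s < ball_mass u x t / ennreal (w t)"
    by (auto simp: less_SUP_iff)
  then have "s * ennreal (w t) < ball_mass u x t"
    using assms(2) by (simp add: ennreal_less_divide_iff)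
  then obtain d where "d > 0" and d: "\<And>y. y \<in> ball x d \<Longrightarrow> s * ennreal (w t) < ball_mass u y t"
    using ball_mass_lower_semicontinuous assms(1) by blast
  have "ball x d \<subseteq> {x. s < (SUP t\<in>{0<..}. ball_mass u x t / ennreal (w t))}"
    using d t(1) assms(2) by (fastforce simp: less_SUP_iff ennreal_less_divide_iff)
  with \<open>d > 0\<close> show "\<exists>d>0. ball x d \<subseteq> {x. s < (SUP t\<in>{0<..}. ball_mass u x t / ennreal (w t))}"
    by blast
qed

lemma borel_measurable_SUP_ball_mass:
  assumes "u \<in> borel_measurable lebesgue" and "\<And>t. 0 < t \<Longrightarrow> 0 < w t"
  shows "(\<lambda>x. SUP t\<in>{0<..}. ball_mass u x t / ennreal (w t)) \<in> borel_measurable borel"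
  using open_SUP_ball_mass[OF assms] by (intro borel_measurableI_greater) auto

lemma borel_measurable_maximal_function:
  "u \<in> borel_measurable lebesgue \<Longrightarrow> maximal_function u \<in> borel_measurable borel"
  unfolding maximal_function_def[abs_def] by (rule borel_measurable_SUP_ball_mass) auto

lemma maximal_function_superlevel_sets [measurable]:
  "u \<in> borel_measurable lebesgue \<Longrightarrow> {x. s < maximal_function u x} \<in> sets lebesgue"
  unfolding maximal_function_def
  by (intro sets_completionI_sets) (simp add: open_SUP_ball_mass)

text \<open>Vitali covering: each point of the superlevel set is the centre of a ball of mass above
  \<open>s * t ^ DIM('a)\<close>. A disjoint subfamily, enlarged five times, covers the set, and the
  masses of the disjoint balls pay for the volumes of the enlarged ones; hence
  \<open>5 ^ DIM('a)\<close>.\<close>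

lemma maximal_function_weak_type:
  fixes u :: "'a::euclidean_space \<Rightarrow> real"
  assumes [measurable]: "u \<in> borel_measurable lebesgue" and s: "0 < s"
  shows "emeasure lebesgue {x. ennreal s < maximal_function u x} \<le>
    ennreal (unit_ball_vol DIM('a) * 5 ^ DIM('a) / s) * (\<integral>\<^sup>+ y. ennreal (u y) \<partial>lebesgue)"
proof (cases "(\<integral>\<^sup>+ y. ennreal (u y) \<partial>lebesgue) = \<infinity>")
  case True
  have "ennreal (unit_ball_vol DIM('a) * 5 ^ DIM('a) / s) \<noteq> 0"
    using s by (simp add: ennreal_eq_0_iff not_le)
  then show ?thesis using True by (simp add: ennreal_mult_top)
next
  case False
  let ?n = "DIM('a)"
  let ?S = "{x. ennreal s < maximal_function u x}"
  let ?N = "density lebesgue (\<lambda>y. ennreal (u y))"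
  have "\<forall>x\<in>?S. \<exists>t>0. ennreal s * ennreal (t ^ ?n) < ball_mass u x t"
    unfolding maximal_function_def by (auto simp: less_SUP_iff ennreal_less_divide_iff)
  then obtain r where r: "\<And>x. x \<in> ?S \<Longrightarrow> 0 < r x"
      "\<And>x. x \<in> ?S \<Longrightarrow> ennreal s * ennreal (r x ^ ?n) < ball_mass u x (r x)"
    by metis
  have mass_le: "ball_mass u x t \<le> (\<integral>\<^sup>+ y. ennreal (u y) \<partial>lebesgue)" for x t
    unfolding ball_mass_def by (intro nn_integral_mono) (auto simp: indicator_def)
  obtain I where I: "(\<integral>\<^sup>+ y. ennreal (u y) \<partial>lebesgue) = ennreal I" "0 \<le> I"
    using False by (cases "\<integral>\<^sup>+ y. ennreal (u y) \<partial>lebesgue") auto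
  \<comment> \<open>The covering lemma needs bounded radii. From \<open>s * r x ^ ?n < I\<close> and
    \<open>r x \<le> r x ^ ?n\<close> for radii above 1 one gets the bound
    \<open>I / s\<close>.\<close>
  have bd: "r x \<le> max 1 (I / s)" if "x \<in> ?S" for x
  proof (rule ccontr)
    assume "\<not> ?thesis"
    then have *: "1 < r x" "I / s < r x" by auto
    have "ennreal (s * r x ^ ?n) < ennreal I"
      using r(2)[OF that] mass_le[of x "r x"] s *(1) unfolding I
      by (simp add: ennreal_mult'' less_le_trans)
    then have "s * r x ^ ?n < I"
      using *(1) s by (simp add: ennreal_less_iff)
    moreover have "r x ^ 1 \<le> r x ^ ?n"
      using *(1) by (intro power_increasing) (auto simp: Suc_le_eq)
    ultimately have "s * r x < I"
      using s by (smt (verit) mult_left_mono power_one_right)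
    with *(2) s show False by (simp add: field_simps)
  qed
  have "?S \<subseteq> (\<Union>x\<in>?S. cball x (r x))"
    using r(1) by (force intro: less_imp_le)
  then obtain C where C: "countable C" "C \<subseteq> ?S"
     "pairwise (\<lambda>i j. disjnt (cball i (r i)) (cball j (r j))) C"
     "?S \<subseteq> (\<Union>i\<in>C. cball i (5 * r i))"
    by (rule Vitali_covering_lemma_cballs[where K = ?S and a = "\<lambda>x. x" and r = r and S = ?S
          and B = "max 1 (I / s)"]) (use r(1) bd in blast)+
  have disj: "disjoint_family_on (\<lambda>i. cball i (r i)) C"
    using C(3) by (auto simp: disjoint_family_on_def pairwise_def disjnt_def)
  have "emeasure lebesgue ?S \<le> emeasure lebesgue (\<Union>i\<in>C. cball i (5 * r i))"
    by (intro emeasure_mono C(4)) (use C(1) in \<open>auto intro!: sets.countable_UN''\<close>)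
  also have "\<dots> \<le> (\<integral>\<^sup>+i. emeasure lebesgue (cball i (5 * r i)) \<partial>count_space C)"
    by (intro emeasure_UN_le_nn_integral_count_space C(1)) auto
  also have "\<dots> \<le> (\<integral>\<^sup>+i. ennreal (unit_ball_vol ?n * 5 ^ ?n / s) *
      emeasure ?N (cball i (r i)) \<partial>count_space C)"
  proof (rule nn_integral_mono)
    fix i assume "i \<in> space (count_space C)"
    then have i: "i \<in> ?S" using C(2) by auto
    have "emeasure lebesgue (cball i (5 * r i)) = ennreal (unit_ball_vol ?n * 5 ^ ?n / s) *
        (ennreal s * ennreal (r i ^ ?n))"
      using r(1)[OF i] s
      by (simp add: emeasure_cball power_mult_distrib ennreal_mult''[symmetric]
          ennreal_mult'[symmetric] mult_ac)
    also have "\<dots> \<le> ennreal (unit_ball_vol ?n * 5 ^ ?n / s) * emeasure ?N (ball i (r i))"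
      using r(2)[OF i] by (intro mult_left_mono) (auto simp: ball_mass_eq_emeasure)
    also have "\<dots> \<le> ennreal (unit_ball_vol ?n * 5 ^ ?n / s) * emeasure ?N (cball i (r i))"
      by (intro mult_left_mono emeasure_mono) auto
    finally show "emeasure lebesgue (cball i (5 * r i)) \<le> \<dots>" .
  qed
  also have "\<dots> = ennreal (unit_ball_vol ?n * 5 ^ ?n / s) *
      (\<integral>\<^sup>+i. emeasure ?N (cball i (r i)) \<partial>count_space C)"
    by (rule nn_integral_cmult) simp
  also have "(\<integral>\<^sup>+i. emeasure ?N (cball i (r i)) \<partial>count_space C) = emeasure ?N (\<Union>i\<in>C. cball i (r i))"
    by (subst emeasure_UN_countable) (use C(1) disj in auto)
  also have "\<dots> \<le> emeasure ?N (space ?N)"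
    by (rule emeasure_space)
  also have "\<dots> = (\<integral>\<^sup>+ y. ennreal (u y) \<partial>lebesgue)"
    by (simp add: emeasure_density)
  finally show ?thesis by (simp add: mult_left_mono)
qed

section \<open>The strong type inequality\<close>

text \<open>\<open>enn2real\<close> sends infinity to 0, so the value at infinity is set
  separately.\<close>

definition ennreal_powr :: "ennreal \<Rightarrow> real \<Rightarrow> ennreal" where
  "ennreal_powr x p = (if x = top then top else ennreal (enn2real x powr p))"

lemma ennreal_powr_ennreal [simp]: "0 \<le> a \<Longrightarrow> ennreal_powr (ennreal a) p = ennreal (a powr p)"
  by (simp add: ennreal_powr_def)

lemma ennreal_powr_mono: "0 \<le> p \<Longrightarrow> x \<le> y \<Longrightarrow> ennreal_powr x p \<le> ennreal_powr y p"
  by (cases x; cases y) (auto simp: ennreal_powr_def top_unique intro!: ennreal_leI powr_mono2)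

lemma ennreal_powr_max: "0 \<le> p \<Longrightarrow> ennreal_powr (max x y) p \<le> ennreal_powr x p + ennreal_powr y p"
  by (auto simp: max_def)

lemma measurable_ennreal_powr [measurable (raw)]:
  assumes [measurable]: "f \<in> borel_measurable M"
  shows "(\<lambda>x. ennreal_powr (f x) p) \<in> borel_measurable M"
  unfolding ennreal_powr_def by measurable

lemma nn_integral_powr_below:
  assumes "0 < p" "0 \<le> a"
  shows "(\<integral>\<^sup>+ s. ennreal (s powr (p - 1)) * indicator {s. 0 < s \<and> s < a} s \<partial>lborel) =
      ennreal (a powr p / p)"
proof -
  have "AE s in lborel. s \<noteq> 0 \<and> s \<noteq> a"
    using AE_lborel_singleton[of 0] AE_lborel_singleton[of a] by eventually_elim auto
  then have "(\<integral>\<^sup>+ s. ennreal (s powr (p - 1)) * indicator {s. 0 < s \<and> s < a} s \<partial>lborel) =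
      (\<integral>\<^sup>+ s. ennreal (indicator {0..a} s * s powr (p - 1)) \<partial>lborel)"
    by (intro nn_integral_cong_AE, elim AE_mp) (auto simp: indicator_def)
  also have "\<dots> = ennreal (a powr (p - 1 + 1) / (p - 1 + 1))"
    using assms by (intro nn_integral_has_integral_lebesgue has_integral_powr_from_0) auto
  finally show ?thesis by simp
qed

text \<open>Stated for a single number, infinity included, so that it applies pointwise to a maximal
  function that may be infinite somewhere.\<close>

lemma ennreal_powr_layer_cake:
  assumes p: "0 < p"
  shows "(\<integral>\<^sup>+ s. ennreal (s powr (p - 1)) * indicator {s. 0 < s \<and> ennreal s < x} s \<partial>lborel) =
    ennreal (1 / p) * ennreal_powr x p"
proof (cases x)
  case (real a)
  have "{s. 0 < s \<and> ennreal s < ennreal a} = {s. 0 < s \<and> s < a}"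
    by (auto simp: ennreal_less_iff)
  then show ?thesis
    using real p by (simp add: nn_integral_powr_below ennreal_mult'[symmetric])
next
  case top
  let ?I = "\<integral>\<^sup>+ s. ennreal (s powr (p - 1)) * indicator {s. 0 < s \<and> ennreal s < top} s \<partial>lborel"
  have "ennreal r \<le> ?I" if "0 \<le> r" for r
  proof -
    \<comment> \<open>Chosen so that \<open>?a powr p / p = r\<close>: the levels below
      \<open>?a\<close> alone contribute \<open>r\<close>.\<close>
    let ?a = "(r * p) powr (1 / p)"
    have "ennreal r = (\<integral>\<^sup>+ s. ennreal (s powr (p - 1)) * indicator {s. 0 < s \<and> s < ?a} s \<partial>lborel)"
      using p that by (simp add: nn_integral_powr_below powr_powr)
    also have "\<dots> \<le> ?I"
      by (intro nn_integral_mono) (auto simp: indicator_def)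
    finally show ?thesis .
  qed
  then have "ennreal r \<le> ?I" for r
    by (cases "0 \<le> r") (auto simp: ennreal_neg)
  then have "?I = top"
  proof (cases ?I)
    case (real a)
    then show ?thesis
      using \<open>\<And>r. ennreal r \<le> ?I\<close>[of "a + 1"] by (simp add: ennreal_le_iff)
  qed simp
  then show ?thesis
    using p top by (simp add: ennreal_powr_def ennreal_mult_top)
qed

text \<open>Where \<open>u\<close> is at most \<open>s / (2 * unit_ball_vol)\<close> it adds at most
  \<open>s / 2\<close> to the maximal function, so a value above \<open>s\<close> forces the
  remaining part \<open>v\<close> to have maximal function above \<open>s / 2\<close>. The weak type
  bound for \<open>v\<close> then involves only the points where \<open>u\<close> is large, which is
  what makes the later integral over levels converge.\<close>

lemma maximal_function_level_set:
  fixes u :: "'a::euclidean_space \<Rightarrow> real"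
  assumes [measurable]: "u \<in> borel_measurable lebesgue" and u: "\<And>y. 0 \<le> u y" and s: "0 < s"
  shows "emeasure lebesgue {x. ennreal s < maximal_function u x} \<le>
    ennreal (unit_ball_vol DIM('a) * 5 ^ DIM('a) * 2 / s) *
    (\<integral>\<^sup>+ y. ennreal (u y) * indicator {y. s < 2 * unit_ball_vol DIM('a) * u y} y \<partial>lebesgue)"
proof -
  let ?\<omega> = "unit_ball_vol (real DIM('a))"
  define v where "v y = (if s < 2 * ?\<omega> * u y then u y else 0)" for y
  have [measurable]: "v \<in> borel_measurable lebesgue"
    unfolding v_def by measurable
  have \<omega>: "0 < ?\<omega>" by simp
  have le: "maximal_function u x \<le> maximal_function v x + ennreal (s / 2)" for x
    unfolding maximal_function_def
  proof (rule SUP_least)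
    fix t :: real assume "t \<in> {0<..}"
    then have t: "0 < t" by simp
    have "ennreal (u y) \<le> ennreal (v y) + ennreal (s / (2 * ?\<omega>))" for y
      using u[of y] s \<omega> by (auto simp: v_def field_simps simp flip: ennreal_plus intro!:
          ennreal_leI)
    then have "ball_mass u x t \<le> (\<integral>\<^sup>+ y. ennreal (v y) * indicator (ball x t) y
        + ennreal (s / (2 * ?\<omega>)) * indicator (ball x t) y \<partial>lebesgue)"
      unfolding ball_mass_def
      by (intro nn_integral_mono) (auto simp: indicator_def)
    also have "\<dots> = ball_mass v x t + ennreal (s / (2 * ?\<omega>)) * emeasure lebesgue (ball x t)"
      unfolding ball_mass_def by (subst nn_integral_add)
          (measurable, simp add: nn_integral_cmult_indicator)
    also have "ennreal (s / (2 * ?\<omega>)) * emeasure lebesgue (ball x t) = ennreal (s / 2) *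
        ennreal (t ^ DIM('a))"
      using t s \<omega> by (simp add: emeasure_ball ennreal_mult'[symmetric] ennreal_mult''[symmetric])
    finally have "ball_mass u x t \<le> ball_mass v x t + ennreal (s / 2) * ennreal (t ^ DIM('a))" .
    then have "ball_mass u x t / ennreal (t ^ DIM('a)) \<le>
        (ball_mass v x t + ennreal (s / 2) * ennreal (t ^ DIM('a))) / ennreal (t ^ DIM('a))"
      by (rule divide_right_mono_ennreal)
    also have "\<dots> = ball_mass v x t / ennreal (t ^ DIM('a)) + ennreal (s / 2)"
      using t by (simp add: add_divide_distrib_ennreal mult_divide_eq_ennreal)
    also have "ball_mass v x t / ennreal (t ^ DIM('a)) \<le>
        (SUP t\<in>{0<..}. ball_mass v x t / ennreal (t ^ DIM('a)))"
      using t by (intro SUP_upper) auto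
    finally show "ball_mass u x t / ennreal (t ^ DIM('a)) \<le>
        (SUP t\<in>{0<..}. ball_mass v x t / ennreal (t ^ DIM('a))) + ennreal (s / 2)"
      by (simp add: add_right_mono)
  qed
  have [measurable]: "maximal_function v \<in> borel_measurable lebesgue"
    using borel_measurable_maximal_function[of v] by (auto intro: measurable_completion)
  have "{x. ennreal s < maximal_function u x} \<subseteq> {x. ennreal (s / 2) < maximal_function v x}"
  proof (clarify, rule ccontr)
    fix x assume *: "ennreal s < maximal_function u x" "\<not> ennreal (s / 2) < maximal_function v x"
    have "maximal_function u x \<le> ennreal (s / 2) + ennreal (s / 2)"
      using le[of x] *(2) by (meson add_right_mono not_less order.trans)
    also have "\<dots> = ennreal s"
      using s by (simp flip: ennreal_plus)
    finally show False using *(1) by simp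
  qed
  then have "emeasure lebesgue {x. ennreal s < maximal_function u x} \<le>
      emeasure lebesgue {x. ennreal (s / 2) < maximal_function v x}"
    by (rule emeasure_mono) (rule maximal_function_superlevel_sets, measurable)
  also have "\<dots> \<le> ennreal (?\<omega> * 5 ^ DIM('a) / (s / 2)) * (\<integral>\<^sup>+ y. ennreal (v y) \<partial>lebesgue)"
    by (rule maximal_function_weak_type) (use s in auto)
  also have "(\<integral>\<^sup>+ y. ennreal (v y) \<partial>lebesgue) =
      (\<integral>\<^sup>+ y. ennreal (u y) * indicator {y. s < 2 * ?\<omega> * u y} y \<partial>lebesgue)"
    by (intro nn_integral_cong) (auto simp: v_def)
  finally show ?thesis by (simp add: mult.commute)
qed

text \<open>Marcinkiewicz interpolation: the level set estimate is integrated against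
  \<open>p * s powr (p - 1)\<close>. After Tonelli the inner integral of
  \<open>s powr (p - 2)\<close> up to \<open>2 * unit_ball_vol * u y\<close> converges at 0 because
  \<open>p > 1\<close>.\<close>

lemma maximal_function_strong_type:
  assumes p: "1 < p"
  obtains C where "0 < C"
    "\<And>u :: 'a::euclidean_space \<Rightarrow> real. u \<in> borel_measurable lebesgue \<Longrightarrow> (\<And>y. 0 \<le> u y) \<Longrightarrow>
      (\<integral>\<^sup>+ x. ennreal_powr (maximal_function u x) p \<partial>lebesgue) \<le>
      ennreal C * (\<integral>\<^sup>+ y. ennreal (u y powr p) \<partial>lebesgue)"
proof
  let ?\<omega> = "unit_ball_vol (real DIM('a))"
  \<comment> \<open>\<open>D\<close> is the constant of the level set estimate. In \<open>C\<close>,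
    the factor \<open>p\<close> belongs to the layer cake formula and the quotient by
    \<open>p - 1\<close> to the inner integral over levels.\<close>
  define D where "D = ?\<omega> * 5 ^ DIM('a) * 2"
  define C where "C = p * D * (2 * ?\<omega>) powr (p - 1) / (p - 1)"
  have \<omega>: "0 < ?\<omega>" by simp
  have D: "0 < D" by (simp add: D_def)
  show "0 < C" unfolding C_def using D \<omega> p by (intro divide_pos_pos mult_pos_pos) auto
  fix u :: "'a \<Rightarrow> real"
  assume [measurable]: "u \<in> borel_measurable lebesgue" and u: "\<And>y. 0 \<le> u y"
  have [measurable]: "maximal_function u \<in> borel_measurable lebesgue"
    using borel_measurable_maximal_function[of u] by (auto intro: measurable_completion)
  have "(\<integral>\<^sup>+ x. ennreal_powr (maximal_function u x) p \<partial>lebesgue) =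
      (\<integral>\<^sup>+ x. \<integral>\<^sup>+ s. ennreal p * (ennreal (s powr (p - 1)) * indicator {s. 0 < s \<and>
          ennreal s < maximal_function u x} s) \<partial>lborel \<partial>lebesgue)"
  proof (intro nn_integral_cong)
    fix x
    have "(\<integral>\<^sup>+ s. ennreal p * (ennreal (s powr (p - 1)) * indicator {s. 0 < s \<and>
        ennreal s < maximal_function u x} s) \<partial>lborel) =
        ennreal p * (ennreal (1 / p) * ennreal_powr (maximal_function u x) p)"
      using p ennreal_powr_layer_cake[of p "maximal_function u x"] by (subst nn_integral_cmult) auto
    also have "\<dots> = ennreal_powr (maximal_function u x) p"
      using p by (simp add: mult.assoc[symmetric] ennreal_mult'[symmetric])
    finally show "ennreal_powr (maximal_function u x) p =
        (\<integral>\<^sup>+ s. ennreal p * (ennreal (s powr (p - 1)) * indicator {s. 0 < s \<and>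
            ennreal s < maximal_function u x} s) \<partial>lborel)" ..
  qed
  also have "\<dots> = (\<integral>\<^sup>+ s. \<integral>\<^sup>+ x. ennreal p * (ennreal (s powr (p - 1)) * indicator {s. 0 < s \<and>
      ennreal s < maximal_function u x} s) \<partial>lebesgue \<partial>lborel)"
    by (rule lebesgue_lborel.Fubini'[symmetric]) measurable
  also have "\<dots> = (\<integral>\<^sup>+ s. ennreal p * (ennreal (s powr (p - 1)) * indicator {0<..} s *
      emeasure lebesgue {x. ennreal s < maximal_function u x}) \<partial>lborel)"
  proof (intro nn_integral_cong)
    fix s :: real
    have "(\<integral>\<^sup>+ x. ennreal p * (ennreal (s powr (p - 1)) * indicator {s. 0 < s \<and>
        ennreal s < maximal_function u x} s) \<partial>lebesgue) =
        (\<integral>\<^sup>+ x. (ennreal p * (ennreal (s powr (p - 1)) * indicator {0<..} s)) *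
            indicator {x. ennreal s < maximal_function u x} x \<partial>lebesgue)"
      by (intro nn_integral_cong) (auto simp: indicator_def)
    also have "\<dots> = (ennreal p * (ennreal (s powr (p - 1)) * indicator {0<..} s)) *
        emeasure lebesgue {x. ennreal s < maximal_function u x}"
      by (rule nn_integral_cmult_indicator) (rule maximal_function_superlevel_sets, measurable)
    finally show "(\<integral>\<^sup>+ x. ennreal p * (ennreal (s powr (p - 1)) * indicator {s. 0 < s \<and>
        ennreal s < maximal_function u x} s) \<partial>lebesgue) =
       ennreal p * (ennreal (s powr (p - 1)) * indicator {0<..} s *
      emeasure lebesgue {x. ennreal s < maximal_function u x})"
      by (simp add: mult.assoc)
  qed
  \<comment> \<open>The exponent \<open>p - 1 - 1\<close> and the condition
    \<open>ennreal s < ennreal (...)\<close> are kept in the shape of the layer cake formula for the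
    exponent \<open>p - 1\<close>.\<close>
  also have "\<dots> \<le> (\<integral>\<^sup>+ s. \<integral>\<^sup>+ y. ennreal (p * D) * (ennreal (u y) * (ennreal (s powr (p - 1 - 1)) *
      indicator {s. 0 < s \<and> ennreal s < ennreal (2 * ?\<omega> * u y)} s)) \<partial>lebesgue \<partial>lborel)"
  proof (intro nn_integral_mono)
    fix s :: real
    show "ennreal p * (ennreal (s powr (p - 1)) * indicator {0<..} s *
      emeasure lebesgue {x. ennreal s < maximal_function u x}) \<le> (\<integral>\<^sup>+ y. ennreal (p * D) *
          (ennreal (u y) * (ennreal (s powr (p - 1 - 1)) *
      indicator {s. 0 < s \<and> ennreal s < ennreal (2 * ?\<omega> * u y)} s)) \<partial>lebesgue)"
    proof (cases "0 < s")
      case True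
      have "ennreal p * (ennreal (s powr (p - 1)) * indicator {0<..} s *
          emeasure lebesgue {x. ennreal s < maximal_function u x}) \<le>
        ennreal p * (ennreal (s powr (p - 1)) * (ennreal (D / s) *
          (\<integral>\<^sup>+ y. ennreal (u y) * indicator {y. s < 2 * ?\<omega> * u y} y \<partial>lebesgue)))"
        using maximal_function_level_set[of u s] u True
        by (intro mult_left_mono) (auto simp: D_def intro!: mult_left_mono)
      also have "\<dots> = ennreal (p * s powr (p - 1) * (D / s)) *
          (\<integral>\<^sup>+ y. ennreal (u y) * indicator {y. s < 2 * ?\<omega> * u y} y \<partial>lebesgue)"
        using p D True by (simp add: mult.assoc[symmetric] ennreal_mult''[symmetric] del:
            times_divide_eq_right)
      also have "p * s powr (p - 1) * (D / s) = p * D * s powr (p - 1 - 1)"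
        using True by (simp add: powr_diff power2_eq_square)
      also have "ennreal (p * D * s powr (p - 1 - 1)) *
          (\<integral>\<^sup>+ y. ennreal (u y) * indicator {y. s < 2 * ?\<omega> * u y} y \<partial>lebesgue) =
          (\<integral>\<^sup>+ y. ennreal (p * D * s powr (p - 1 - 1)) * (ennreal (u y) * indicator {y. s < 2 *
              ?\<omega> * u y} y) \<partial>lebesgue)"
        by (rule nn_integral_cmult[symmetric]) measurable
      also have "\<dots> = (\<integral>\<^sup>+ y. ennreal (p * D) * (ennreal (u y) * (ennreal (s powr (p - 1 - 1)) *
          indicator {s. 0 < s \<and> ennreal s < ennreal (2 * ?\<omega> * u y)} s)) \<partial>lebesgue)"
        using True D p
        by (intro nn_integral_cong) (auto simp: ennreal_less_iff ennreal_mult' mult_ac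
            indicator_def)
      finally show ?thesis .
    qed simp
  qed
  also have "\<dots> = (\<integral>\<^sup>+ y. \<integral>\<^sup>+ s. ennreal (p * D) * (ennreal (u y) * (ennreal (s powr (p - 1 - 1)) *
      indicator {s. 0 < s \<and> ennreal s < ennreal (2 * ?\<omega> * u y)} s)) \<partial>lborel \<partial>lebesgue)"
    by (rule lebesgue_lborel.Fubini') measurable
  also have "\<dots> = (\<integral>\<^sup>+ y. ennreal C * ennreal (u y powr p) \<partial>lebesgue)"
  proof (intro nn_integral_cong)
    fix y
    have "0 \<le> 2 * ?\<omega> * u y" using u by simp
    then have layer: "(\<integral>\<^sup>+ s. ennreal (s powr (p - 1 - 1)) *
      indicator {s. 0 < s \<and> ennreal s < ennreal (2 * ?\<omega> * u y)} s \<partial>lborel) =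
      ennreal (1 / (p - 1)) * ennreal ((2 * ?\<omega> * u y) powr (p - 1))"
      using p by (subst ennreal_powr_layer_cake) (simp, simp only: ennreal_powr_ennreal)
    have outer: "(\<integral>\<^sup>+ s. ennreal (p * D) * (ennreal (u y) * (ennreal (s powr (p - 1 - 1)) *
      indicator {s. 0 < s \<and> ennreal s < ennreal (2 * ?\<omega> * u y)} s)) \<partial>lborel) =
      ennreal (p * D) * (\<integral>\<^sup>+ s. ennreal (u y) * (ennreal (s powr (p - 1 - 1)) *
      indicator {s. 0 < s \<and> ennreal s < ennreal (2 * ?\<omega> * u y)} s) \<partial>lborel)"
      by (rule nn_integral_cmult) measurable
    have inner: "(\<integral>\<^sup>+ s. ennreal (u y) * (ennreal (s powr (p - 1 - 1)) *
      indicator {s. 0 < s \<and> ennreal s < ennreal (2 * ?\<omega> * u y)} s) \<partial>lborel) =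
      ennreal (u y) * (\<integral>\<^sup>+ s. ennreal (s powr (p - 1 - 1)) *
      indicator {s. 0 < s \<and> ennreal s < ennreal (2 * ?\<omega> * u y)} s \<partial>lborel)"
      by (rule nn_integral_cmult) measurable
    have "(\<integral>\<^sup>+ s. ennreal (p * D) * (ennreal (u y) * (ennreal (s powr (p - 1 - 1)) *
      indicator {s. 0 < s \<and> ennreal s < ennreal (2 * ?\<omega> * u y)} s)) \<partial>lborel) = ennreal (p * D *
          (u y * (1 / (p - 1) * (2 * ?\<omega> * u y) powr (p - 1))))"
    proof -
      have "0 \<le> p * D" "0 \<le> u y" "0 \<le> 1 / (p - 1)" using p u D by auto
      then show ?thesis unfolding outer inner layer by (simp only: ennreal_mult')
    qed
    also have "p * D * (u y * (1 / (p - 1) * (2 * ?\<omega> * u y) powr (p - 1))) = C * u y powr p"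
    proof -
      have "u y * u y powr (p - 1) = u y powr p"
        using u[of y] by (cases "u y = 0") (auto simp: powr_diff)
      then show ?thesis
        using u[of y] \<omega> unfolding C_def by (simp add: powr_mult mult_ac)
    qed
    also have "ennreal (C * u y powr p) = ennreal C * ennreal (u y powr p)"
      using \<open>0 < C\<close> by (simp add: ennreal_mult')
    finally show "(\<integral>\<^sup>+ s. ennreal (p * D) * (ennreal (u y) * (ennreal (s powr (p - 1 - 1)) *
      indicator {s. 0 < s \<and> ennreal s < ennreal (2 * ?\<omega> * u y)} s)) \<partial>lborel) = ennreal C *
          ennreal (u y powr p)" .
  qed
  also have "\<dots> = ennreal C * (\<integral>\<^sup>+ y. ennreal (u y powr p) \<partial>lebesgue)"
    by (rule nn_integral_cmult) measurable
  finally show "(\<integral>\<^sup>+ x. ennreal_powr (maximal_function u x) p \<partial>lebesgue) \<le>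
      ennreal C * (\<integral>\<^sup>+ y. ennreal (u y powr p) \<partial>lebesgue)" .
qed

section \<open>The local maximal estimate and Hedberg's inequality\<close>

lemma maximal_function_upper:
  "0 < t \<Longrightarrow> ball_mass u x t \<le> maximal_function u x * ennreal (t ^ DIM('a))"
  for u :: "'a::euclidean_space \<Rightarrow> real"
proof -
  assume t: "0 < t"
  have "ball_mass u x t / ennreal (t ^ DIM('a)) \<le> maximal_function u x"
    unfolding maximal_function_def using t by (intro SUP_upper) auto
  then show ?thesis
    using t by (metis ennreal_less_divide_iff not_less zero_less_power)
qed

text \<open>The pointwise bound \<open>u \<le> a + a powr (1 - p) * u powr p\<close> with \<open>a\<close> the \<open>p\<close>-th root of \<open>\<sigma>\<close>
  takes the place of Hoelder's inequality.\<close>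

lemma ball_mass_le_of_powr:
  fixes u :: "'a::euclidean_space \<Rightarrow> real"
  assumes [measurable]: "u \<in> borel_measurable lebesgue" and u: "\<And>y. 0 \<le> u y"
    and p: "1 \<le> p" and \<sigma>: "0 < \<sigma>" and t: "0 \<le> t"
    and le: "ball_mass (\<lambda>y. u y powr p) x t \<le> ennreal (\<sigma> * t ^ DIM('a))"
  shows "ball_mass u x t \<le> ennreal ((unit_ball_vol DIM('a) + 1) * \<sigma> powr (1 / p) * t ^ DIM('a))"
proof -
  let ?\<omega> = "unit_ball_vol (real DIM('a))"
  define a where "a = \<sigma> powr (1 / p)"
  have a: "0 < a" using \<sigma> by (simp add: a_def)
  have a_p: "a powr p = \<sigma>" using \<sigma> p by (simp add: a_def powr_powr)
  have *: "u y \<le> a + a powr (1 - p) * u y powr p" for y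
  proof (cases "u y \<le> a")
    case True
    then show ?thesis using a by (simp add: add_increasing2)
  next
    case False
    then have "0 < u y" using a by linarith
    have "u y powr (1 - p) \<le> a powr (1 - p)"
      using False p a by (intro powr_mono2') auto
    then have "u y powr (1 - p) * u y powr p \<le> a powr (1 - p) * u y powr p"
      by (intro mult_right_mono) auto
    also have "u y powr (1 - p) * u y powr p = u y"
      using \<open>0 < u y\<close> by (simp flip: powr_add)
    finally show ?thesis using a by simp
  qed
  have "ball_mass u x t \<le> (\<integral>\<^sup>+ y. ennreal a * indicator (ball x t) y
      + ennreal (a powr (1 - p)) * (ennreal (u y powr p) * indicator (ball x t) y) \<partial>lebesgue)"
    unfolding ball_mass_def using * a
    by (intro nn_integral_mono)
      (auto simp: indicator_def ennreal_mult'[symmetric] simp flip: ennreal_plus intro!: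
          ennreal_leI)
  also have "\<dots> = ennreal a * emeasure lebesgue (ball x t) + ennreal (a powr (1 - p)) *
      ball_mass (\<lambda>y. u y powr p) x t"
    unfolding ball_mass_def by (subst nn_integral_add)
        (measurable, simp add: nn_integral_cmult nn_integral_cmult_indicator)
  also have "\<dots> \<le> ennreal a * emeasure lebesgue (ball x t) + ennreal (a powr (1 - p)) * ennreal (\<sigma> *
      t ^ DIM('a))"
    by (intro add_left_mono mult_left_mono le) auto
  also have "\<dots> = ennreal (a * (?\<omega> * t ^ DIM('a)) + a powr (1 - p) * (\<sigma> * t ^ DIM('a)))"
    using a t \<sigma> by (simp add: emeasure_ball ennreal_mult'[symmetric])
  also have "a * (?\<omega> * t ^ DIM('a)) + a powr (1 - p) * (\<sigma> * t ^ DIM('a)) = (?\<omega> + 1) * a *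
      t ^ DIM('a)"
  proof -
    have "a powr (1 - p) * \<sigma> = a"
      using a by (simp flip: a_p powr_add)
    then show ?thesis by (simp add: algebra_simps)
  qed
  finally show ?thesis by (simp add: a_def)
qed

text \<open>A ball of radius below \<open>r\<close> about a point of \<open>ball x r\<close> stays
  in \<open>ball x (2 * r)\<close>, so it sees only the truncation \<open>v\<close>, to which the
  strong type inequality applies. For a radius \<open>t \<ge> r\<close> the density bound on
  \<open>u powr p\<close> yields a pointwise bound on the average of \<open>u\<close>.\<close>

lemma maximal_function_local_bound:
  assumes p: "1 < p"
  obtains C where "0 < C"
    "\<And>(u :: 'a::euclidean_space \<Rightarrow> real) \<sigma> r x.
      \<lbrakk>u \<in> borel_measurable lebesgue; \<And>y. 0 \<le> u y; 0 < \<sigma>; 0 < r;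
       \<And>y t. y \<in> ball x r \<Longrightarrow> r \<le> t \<Longrightarrow> ball_mass (\<lambda>y. u y powr p) y t \<le> ennreal (\<sigma> * t ^ DIM('a))\<rbrakk> \<Longrightarrow>
      (\<integral>\<^sup>+ y\<in>ball x r. ennreal_powr (maximal_function u y) p \<partial>lebesgue) \<le> ennreal (C * \<sigma> *
          r ^ DIM('a))"
proof -
  let ?n = "DIM('a)" and ?\<omega> = "unit_ball_vol (real DIM('a))"
  obtain C where C: "0 < C"
    "\<And>u :: 'a \<Rightarrow> real. u \<in> borel_measurable lebesgue \<Longrightarrow> (\<And>y. 0 \<le> u y) \<Longrightarrow>
      (\<integral>\<^sup>+ x. ennreal_powr (maximal_function u x) p \<partial>lebesgue) \<le>
      ennreal C * (\<integral>\<^sup>+ y. ennreal (u y powr p) \<partial>lebesgue)"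
    using maximal_function_strong_type[OF p] by metis
  have \<omega>: "0 < ?\<omega>" by simp
  show thesis
  proof
    \<comment> \<open>The first summand is the strong type bound for \<open>v\<close>, with
      \<open>2 ^ ?n\<close> from doubling the radius; the second is the constant bound
      \<open>?s\<close> for large radii, integrated over the ball.\<close>
    show "0 < C * 2 ^ ?n + (?\<omega> + 1) powr p * ?\<omega>"
      using C(1) by (simp add: add_pos_nonneg)
    fix u :: "'a \<Rightarrow> real" and \<sigma> r x
    assume [measurable]: "u \<in> borel_measurable lebesgue" and u: "\<And>y. 0 \<le>
        u y" and \<sigma>: "0 < \<sigma>" and r: "0 < r"
      and J: "\<And>y t. y \<in> ball x r \<Longrightarrow> r \<le> t \<Longrightarrow> ball_mass (\<lambda>y. u y powr p) y t \<le> ennreal (\<sigma> * t ^ ?n)"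
    define v where "v y = (if y \<in> ball x (2 * r) then u y else 0)" for y
    have [measurable]: "v \<in> borel_measurable lebesgue"
      unfolding v_def by measurable
    have v: "0 \<le> v y" for y using u by (simp add: v_def)
    let ?s = "(?\<omega> + 1) * \<sigma> powr (1 / p)"
    have s: "0 \<le> ?s" using \<omega> by simp
    have [measurable]: "maximal_function v \<in> borel_measurable lebesgue"
      using borel_measurable_maximal_function[of v] by (auto intro: measurable_completion)
    have max: "maximal_function u y \<le> max (maximal_function v y) (ennreal ?s)" if y: "y \<in> ball x r"
        for y
      unfolding maximal_function_def[of u]
    proof (rule SUP_least)
      fix t :: real assume "t \<in> {0<..}"
      then have t: "0 < t" by simp
      show "ball_mass u y t / ennreal (t ^ ?n) \<le> max (maximal_function v y) (ennreal ?s)"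
      proof (cases "r \<le> t")
        case True
        have "ball_mass u y t \<le> ennreal (?s * t ^ ?n)"
          using ball_mass_le_of_powr[OF _ u _ \<sigma> _ J[OF y True]] p t by simp
        then have "ball_mass u y t \<le> ennreal ?s * ennreal (t ^ ?n)"
          using s by (simp add: ennreal_mult')
        then have "ball_mass u y t / ennreal (t ^ ?n) \<le> ennreal ?s"
          using t by (metis ennreal_less_divide_iff not_less zero_less_power)
        then show ?thesis by (simp add: le_max_iff_disj)
      next
        case False
        have "ball y t \<subseteq> ball x (2 * r)"
        proof
          fix z assume "z \<in> ball y t"
          then show "z \<in> ball x (2 * r)"
            using y False dist_triangle[of x z y] by simp
        qed
        then have "ball_mass u y t \<le> ball_mass v y t"
          by (intro ball_mass_mono_fun) (auto simp: v_def)
        also have "\<dots> \<le> maximal_function v y * ennreal (t ^ ?n)"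
          using t by (rule maximal_function_upper)
        finally have "ball_mass u y t / ennreal (t ^ ?n) \<le> maximal_function v y"
          using t by (metis ennreal_less_divide_iff not_less zero_less_power)
        then show ?thesis by (simp add: le_max_iff_disj)
      qed
    qed
    have "(\<integral>\<^sup>+ y\<in>ball x r. ennreal_powr (maximal_function u y) p \<partial>lebesgue) \<le>
        (\<integral>\<^sup>+ y. ennreal_powr (maximal_function v y) p + ennreal (?s powr p) *
            indicator (ball x r) y \<partial>lebesgue)"
    proof (rule nn_integral_mono)
      fix y
      show "ennreal_powr (maximal_function u y) p * indicator (ball x r) y \<le>
        ennreal_powr (maximal_function v y) p + ennreal (?s powr p) * indicator (ball x r) y"
      proof (cases "y \<in> ball x r")
        case True
        have "ennreal_powr (maximal_function u y) p \<le>
            ennreal_powr (max (maximal_function v y) (ennreal ?s)) p"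
          using max[OF True] p by (intro ennreal_powr_mono) auto
        also have "\<dots> \<le> ennreal_powr (maximal_function v y) p + ennreal (?s powr p)"
          using ennreal_powr_max[of p "maximal_function v y" "ennreal ?s"] p s by simp
        finally show ?thesis using True by simp
      qed simp
    qed
    also have "\<dots> = (\<integral>\<^sup>+ y. ennreal_powr (maximal_function v y) p \<partial>lebesgue)
        + ennreal (?s powr p) * emeasure lebesgue (ball x r)"
      by (subst nn_integral_add) (measurable, simp add: nn_integral_cmult_indicator)
    also have "\<dots> \<le> ennreal C * (\<integral>\<^sup>+ y. ennreal (v y powr p) \<partial>lebesgue)
        + ennreal (?s powr p) * emeasure lebesgue (ball x r)"
      by (intro add_right_mono C(2) v) measurable
    also have "(\<integral>\<^sup>+ y. ennreal (v y powr p) \<partial>lebesgue) = ball_mass (\<lambda>y. u y powr p) x (2 * r)"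
      unfolding ball_mass_def by (intro nn_integral_cong) (auto simp: v_def indicator_def)
    \<comment> \<open>The hypothesis is used at the centre \<open>x\<close> itself, with radius
      \<open>2 * r\<close>.\<close>
    also have "ennreal C * ball_mass (\<lambda>y. u y powr p) x (2 * r) \<le> ennreal C * ennreal (\<sigma> * (2 *
        r) ^ ?n)"
      using r by (intro mult_left_mono J) auto
    also have "ennreal C * ennreal (\<sigma> * (2 * r) ^ ?n) + ennreal (?s powr p) *
        emeasure lebesgue (ball x r) =
        ennreal (C * (\<sigma> * (2 * r) ^ ?n) + ?s powr p * (?\<omega> * r ^ ?n))"
      using C(1) \<sigma> r by (simp add: emeasure_ball ennreal_mult'[symmetric])
    also have "?s powr p = (?\<omega> + 1) powr p * \<sigma>"
      using \<sigma> p \<omega> by (simp add: powr_mult powr_powr)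
    finally show "(\<integral>\<^sup>+ y\<in>ball x r. ennreal_powr (maximal_function u y) p \<partial>lebesgue) \<le>
        ennreal ((C * 2 ^ ?n + (?\<omega> + 1) powr p * ?\<omega>) * \<sigma> * r ^ ?n)"
      by (simp add: algebra_simps power_mult_distrib add_right_mono)
  qed
qed

text \<open>Up to the factor \<open>n - \<alpha>\<close> this is the Riesz potential of \<open>u\<close>. The kernel it encodes is
  infinite at \<open>0\<close>, whereas \<open>0 powr (\<alpha> - n) = 0\<close>, so it dominates the integrands of the four
  operators everywhere.\<close>

definition layer_potential :: "real \<Rightarrow> ('a::euclidean_space \<Rightarrow> real) \<Rightarrow> 'a \<Rightarrow> ennreal" where
  "layer_potential \<alpha> u x =
     (\<integral>\<^sup>+ t\<in>{0<..}. ennreal (t powr (\<alpha> - real DIM('a) - 1)) * ball_mass u x t \<partial>lborel)"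

section \<open>Estimates of the potential at a single point\<close>

lemma nn_integral_powr_above:
  assumes "0 < b" "0 < a"
  shows "(\<integral>\<^sup>+ t. ennreal (t powr (- b - 1)) * indicator {a..} t \<partial>lborel) =
      ennreal (a powr (- b) / b)"
proof -
  have "(\<integral>\<^sup>+ t. ennreal (t powr (- b - 1)) * indicator {a..} t \<partial>lborel) =
      (\<integral>\<^sup>+ t. ennreal (indicator {a..} t * t powr (- b - 1)) \<partial>lborel)"
    by (intro nn_integral_cong) (auto simp: indicator_def)
  also have "\<dots> = ennreal (- (a powr (- b - 1 + 1)) / (- b - 1 + 1))"
    using assms by (intro nn_integral_has_integral_lebesgue has_integral_powr_to_inf) auto
  finally show ?thesis by simp
qed

text \<open>Masses of order \<open>t ^ DIM('a)\<close> leave \<open>t powr (\<alpha> - 1)\<close>,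
  integrable at 0; the additional decay leaves \<open>t powr (- \<beta> - 1)\<close>, integrable at
  infinity. The splitting radius \<open>\<delta>\<close> stays free: it is optimised for Hedberg's
  inequality and set to 1 for mere finiteness.\<close>

lemma layer_potential_le_split:
  fixes u :: "'a::euclidean_space \<Rightarrow> real"
  assumes \<alpha>: "0 < \<alpha>" and \<beta>: "0 < \<beta>" and \<delta>: "0 < \<delta>" and "0 \<le> m" "0 \<le> k"
    and near: "\<And>t. 0 < t \<Longrightarrow> ball_mass u x t \<le> ennreal (m * t ^ DIM('a))"
    and far: "\<And>t. 0 < t \<Longrightarrow> ball_mass u x t \<le> ennreal (k * t powr (- \<alpha> - \<beta>) * t ^ DIM('a))"
  shows "layer_potential \<alpha> u x \<le> ennreal (m * \<delta> powr \<alpha> / \<alpha> + k * \<delta> powr (- \<beta>) / \<beta>)"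
proof -
  have pw: "t powr (\<alpha> - real DIM('a) - 1) * t ^ DIM('a) = t powr (\<alpha> - 1)" if "0 < t" for t
    using that by (simp add: powr_realpow[symmetric] powr_add[symmetric])
  have "layer_potential \<alpha> u x \<le> (\<integral>\<^sup>+ t. ennreal m * (ennreal (t powr (\<alpha> - 1)) *
      indicator {t. 0 < t \<and> t < \<delta>} t)
      + ennreal k * (ennreal (t powr (- \<beta> - 1)) * indicator {\<delta>..} t) \<partial>lborel)"
    unfolding layer_potential_def
  proof (rule nn_integral_mono)
    fix t :: real
    consider "t \<le> 0" | "0 < t" "t < \<delta>" | "0 < t" "\<delta> \<le> t" by linarith
    then show "ennreal (t powr (\<alpha> - real DIM('a) - 1)) * ball_mass u x t * indicator {0<..} t \<le>
       ennreal m * (ennreal (t powr (\<alpha> - 1)) * indicator {t. 0 < t \<and> t < \<delta>} t)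
      + ennreal k * (ennreal (t powr (- \<beta> - 1)) * indicator {\<delta>..} t)"
    proof cases
      case 2
      have "ennreal (t powr (\<alpha> - real DIM('a) - 1)) * ball_mass u x t \<le>
          ennreal (t powr (\<alpha> - real DIM('a) - 1)) * ennreal (m * t ^ DIM('a))"
        using 2 by (intro mult_left_mono near) auto
      also have "\<dots> = ennreal (m * (t powr (\<alpha> - real DIM('a) - 1) * t ^ DIM('a)))"
        by (subst ennreal_mult'[symmetric]) (simp_all add: mult_ac)
      also have "\<dots> = ennreal m * ennreal (t powr (\<alpha> - 1))"
        using 2 \<open>0 \<le> m\<close> by (simp add: pw ennreal_mult')
      finally show ?thesis using 2 by simp
    next
      case 3
      have "ennreal (t powr (\<alpha> - real DIM('a) - 1)) * ball_mass u x t \<le>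
          ennreal (t powr (\<alpha> - real DIM('a) - 1)) * ennreal (k * t powr (- \<alpha> - \<beta>) * t ^ DIM('a))"
        using 3 by (intro mult_left_mono far) auto
      also have "\<dots> = ennreal (k * ((t powr (\<alpha> - real DIM('a) - 1) * t ^ DIM('a)) *
          t powr (- \<alpha> - \<beta>)))"
        by (subst ennreal_mult'[symmetric]) (simp_all add: mult_ac)
      also have "\<dots> = ennreal (k * t powr (\<alpha> - 1 + (- \<alpha> - \<beta>)))"
        using 3 by (simp only: pw powr_add)
      also have "\<alpha> - 1 + (- \<alpha> - \<beta>) = - \<beta> - 1"
        by simp
      also have "ennreal (k * t powr (- \<beta> - 1)) = ennreal k * ennreal (t powr (- \<beta> - 1))"
        using \<open>0 \<le> k\<close> by (rule ennreal_mult')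
      finally show ?thesis using 3 by simp
    qed simp
  qed
  also have "\<dots> = ennreal m * ennreal (\<delta> powr \<alpha> / \<alpha>) + ennreal k * ennreal (\<delta> powr (- \<beta>) / \<beta>)"
    using \<alpha> \<beta> \<delta> nn_integral_powr_below[of \<alpha> \<delta>] nn_integral_powr_above[of \<beta> \<delta>]
    by (subst nn_integral_add) (measurable, simp add: nn_integral_cmult)
  also have "\<dots> = ennreal (m * \<delta> powr \<alpha> / \<alpha> + k * \<delta> powr (- \<beta>) / \<beta>)"
    using assms by (simp add: ennreal_mult'[symmetric])
  finally show ?thesis .
qed

text \<open>The local maximal estimate measures masses against \<open>t ^ n\<close>; read this way,
  a Morrey bound is a density \<open>t powr (l - n)\<close>, decreasing in \<open>t\<close> when
  \<open>l < n\<close>.\<close>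

lemma powr_split_dim:
  fixes t :: real
  assumes "0 < t"
  shows "t powr l = t powr (l - real n) * t ^ n"
  using assms by (simp add: powr_realpow[symmetric] powr_add[symmetric])

text \<open>At a fixed radius the Morrey bound is a density bound with
  \<open>\<sigma> = K powr p * t powr (l - n)\<close>, and the decay is its \<open>p\<close>-th
  root. The exponent \<open>(n - l) / p\<close> is the number that has to exceed
  \<open>\<alpha>\<close>.\<close>

lemma ball_mass_le_of_morrey_bound:
  fixes u :: "'a::euclidean_space \<Rightarrow> real"
  assumes "u \<in> borel_measurable lebesgue" "\<And>y. 0 \<le> u y" "1 \<le> p" "0 < K" and t: "0 < t"
    and J: "ball_mass (\<lambda>y. u y powr p) x t \<le> ennreal (K powr p * t powr l)"
  shows "ball_mass u x t \<le>
    ennreal ((unit_ball_vol DIM('a) + 1) * K * t powr (- ((real DIM('a) - l) / p)) * t ^ DIM('a))"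
proof -
  have "ball_mass (\<lambda>y. u y powr p) x t \<le> ennreal (K powr p * t powr (l - real DIM('a)) *
      t ^ DIM('a))"
    using J unfolding powr_split_dim[OF t, of l "DIM('a)"] by (simp add: mult.assoc)
  then have "ball_mass u x t \<le>
      ennreal ((unit_ball_vol DIM('a) + 1) * (K powr p * t powr (l - real DIM('a))) powr (1 / p) *
          t ^ DIM('a))"
    using assms by (intro ball_mass_le_of_powr) auto
  also have "(K powr p * t powr (l - real DIM('a))) powr (1 / p) = K *
      t powr (- ((real DIM('a) - l) / p))"
  proof -
    have "(l - real DIM('a)) * (1 / p) = - ((real DIM('a) - l) / p)" by
        (simp add: diff_divide_distrib)
    then show ?thesis using assms by (simp add: powr_mult powr_powr)
  qed
  finally show ?thesis by (simp add: mult.assoc)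
qed

text \<open>The near part of the potential is controlled by the value \<open>m\<close> of the
  maximal function, the far part by \<open>K\<close>. At the balancing radius both are multiples of
  \<open>K powr (1 - p / q) * m powr (p / q)\<close>, whose \<open>q\<close>-th power is the right
  side. A real number \<open>v\<close> below the potential is used because that is what the
  operators supply.\<close>

lemma hedberg_pointwise:
  fixes u :: "'a::euclidean_space \<Rightarrow> real"
  assumes [measurable]: "u \<in> borel_measurable lebesgue" and u: "\<And>y. 0 \<le> u y"
    and \<alpha>: "0 < \<alpha>" and l: "l < real DIM('a)" and p: "1 < p" "p < (real DIM('a) - l) / \<alpha>"
    and q: "1 / q = 1 / p - \<alpha> / (real DIM('a) - l)"
    and K: "0 < K" and J: "\<And>t. 0 < t \<Longrightarrow> ball_mass (\<lambda>y. u y powr p) x t \<le> ennreal (K powr p *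
        t powr l)"
    and v: "0 \<le> v" "ennreal v \<le> layer_potential \<alpha> u x"
  shows "ennreal (v powr q) \<le>
    ennreal ((1 / \<alpha> + (unit_ball_vol DIM('a) + 1) / ((real DIM('a) - l) / p - \<alpha>)) powr q *
        K powr (q - p)) *
    ennreal_powr (maximal_function u x) p"
proof -
  let ?n = "real DIM('a)" and ?\<omega> = "unit_ball_vol (real DIM('a))"
  define \<beta> where "\<beta> = (?n - l) / p - \<alpha>"
  define c where "c = ?\<omega> + 1"
  have c: "0 < c" by (simp add: c_def add_pos_pos)
  have \<beta>: "0 < \<beta>" using p \<alpha> l by (simp add: \<beta>_def field_simps)
  have \<gamma>: "\<alpha> + \<beta> = (?n - l) / p" by (simp add: \<beta>_def)
  \<comment> \<open>Since \<open>\<alpha> + \<beta> = (?n - l) / p\<close>, the relation for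
    \<open>q\<close> becomes a ratio of \<open>\<beta>\<close> and
    \<open>\<alpha> + \<beta>\<close>; it also yields \<open>q > 0\<close>.\<close>
  have pq: "p / q = \<beta> / (\<alpha> + \<beta>)"
  proof -
    have "p / q = p * (1 / q)" by simp
    also have "\<dots> = \<beta> / (\<alpha> + \<beta>)" unfolding q \<gamma> unfolding \<beta>_def using p l by (simp add: field_simps)
    finally show ?thesis .
  qed
  then have "0 < p / q" using \<alpha> \<beta> by simp
  then have q0: "0 < q" using p by (simp add: zero_less_divide_iff)
  have B: "0 < 1 / \<alpha> + c / \<beta>" using \<alpha> \<beta> c by (simp add: add_pos_pos)
  have far: "ball_mass u x t \<le> ennreal (c * K * t powr (- \<alpha> - \<beta>) * t ^ DIM('a))" if t: "0 < t" for t
  proof -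
    have "- \<alpha> - \<beta> = - ((?n - l) / p)" using \<gamma> by simp
    then show ?thesis
      using ball_mass_le_of_morrey_bound[OF assms(1) u _ K t J[OF t]] p by (simp only: c_def)
  qed
  show ?thesis
  proof (cases "maximal_function u x")
    case top
    then show ?thesis
      using B K by (simp add: ennreal_powr_def ennreal_mult_top c_def \<beta>_def)
  next
    case (real m)
    have near: "ball_mass u x t \<le> ennreal (m * t ^ DIM('a))" if t: "0 < t" for t
      using maximal_function_upper[OF t, of u x] real by (simp add: ennreal_mult')
    have split: "v \<le> m * \<delta> powr \<alpha> / \<alpha> + c * K * \<delta> powr (- \<beta>) / \<beta>" if \<delta>: "0 < \<delta>" for \<delta>
    proof -
      have "ennreal v \<le> ennreal (m * \<delta> powr \<alpha> / \<alpha> + c * K * \<delta> powr (- \<beta>) / \<beta>)"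
        by (rule order.trans[OF v(2) layer_potential_le_split[OF \<alpha> \<beta> \<delta> real(1) _ near far]])
            (use c K in auto)
      moreover have "0 \<le> m * \<delta> powr \<alpha> / \<alpha> + c * K * \<delta> powr (- \<beta>) / \<beta>"
        using real(1) \<alpha> \<beta> c K by simp
      ultimately show ?thesis by (simp add: ennreal_le_iff)
    qed
    show ?thesis
    proof (cases "m = 0")
      case True
      \<comment> \<open>If \<open>m = 0\<close>, every ball about \<open>x\<close> has mass 0 and
        the potential vanishes. The case is separate because the splitting radius divides by
        \<open>m\<close>.\<close>
      have "layer_potential \<alpha> u x = (\<integral>\<^sup>+ t. 0 \<partial>(lborel :: real measure))"
        unfolding layer_potential_def using near True
        by (intro nn_integral_cong) (auto simp: indicator_def)
      then show ?thesis using v by simp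
    next
      case False
      then have m: "0 < m" using real(1) by simp
      \<comment> \<open>The solution of
        \<open>m * \<delta> powr \<alpha> = K * \<delta> powr (- \<beta>)\<close>, so that near and
        far part balance.\<close>
      define \<delta> where "\<delta> = (K / m) powr (1 / (\<alpha> + \<beta>))"
      have "0 < \<delta>" using K m by (simp add: \<delta>_def)
      have \<theta>: "\<alpha> / (\<alpha> + \<beta>) = 1 - p / q"
        unfolding pq using \<alpha> \<beta> by (simp add: field_simps)
      have 1: "m * \<delta> powr \<alpha> = K powr (1 - p / q) * m powr (p / q)"
      proof -
        have "m * \<delta> powr \<alpha> = m * (K / m) powr (1 - p / q)"
          using \<theta> by (simp add: \<delta>_def powr_powr)
        also have "\<dots> = K powr (1 - p / q) * (m powr 1 / m powr (1 - p / q))"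
          using K m by (simp add: powr_divide)
        also have "\<dots> = K powr (1 - p / q) * m powr (p / q)"
          using m powr_diff[of m 1 "1 - p / q"] by simp
        finally show ?thesis .
      qed
      have 2: "K * \<delta> powr (- \<beta>) = K powr (1 - p / q) * m powr (p / q)"
      proof -
        have "K * \<delta> powr (- \<beta>) = K * (K / m) powr (- (p / q))"
          using pq by (simp add: \<delta>_def powr_powr)
        also have "\<dots> = (K powr 1 / K powr (p / q)) * m powr (p / q)"
          using K m by (simp add: powr_divide powr_minus_divide field_simps)
        also have "\<dots> = K powr (1 - p / q) * m powr (p / q)"
          using K powr_diff[of K 1 "p / q"] by simp
        finally show ?thesis .
      qed
      have "v \<le> m * \<delta> powr \<alpha> / \<alpha> + c * (K * \<delta> powr (- \<beta>)) / \<beta>"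
        using split[OF \<open>0 < \<delta>\<close>] by (simp add: mult.assoc)
      also have "\<dots> = (1 / \<alpha> + c / \<beta>) * (K powr (1 - p / q) * m powr (p / q))"
        unfolding 1 2 by (simp add: algebra_simps)
      finally have "v powr q \<le> ((1 / \<alpha> + c / \<beta>) * (K powr (1 - p / q) * m powr (p / q))) powr q"
        using v q0 by (intro powr_mono2) auto
      also have "\<dots> = (1 / \<alpha> + c / \<beta>) powr q * K powr (q - p) * m powr p"
      proof -
        have "(1 - p / q) * q = q - p" "p / q * q = p" using q0 by (auto simp: field_simps)
        then show ?thesis using B K m by (simp add: powr_mult powr_powr del: times_divide_eq_left)
      qed
      finally have "ennreal (v powr q) \<le> ennreal ((1 / \<alpha> + c / \<beta>) powr q * K powr (q - p) *
          m powr p)"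
        by (rule ennreal_leI)
      then show ?thesis
        using real by (simp add: ennreal_mult' c_def \<beta>_def)
    qed
  qed
qed

section \<open>Morrey bounds and vanishing properties of the potential\<close>

text \<open>Hedberg's inequality integrated over \<open>ball x r\<close> and combined with the local
  maximal estimate. The global bound contributes only \<open>K powr (q - p)\<close>, while
  \<open>\<sigma>\<close> enters linearly, so smallness of the local density passes to
  \<open>g\<close>. Here \<open>g\<close> stands for the pointwise norm of
  \<open>T f\<close>.\<close>

lemma potential_local_bound:
  fixes \<alpha> l p q c :: real
  assumes \<alpha>: "0 < \<alpha>" and l: "l < real DIM('a::euclidean_space)"
    and p: "1 < p" "p < (real DIM('a) - l) / \<alpha>"
    and q: "1 / q = 1 / p - \<alpha> / (real DIM('a) - l)" and c: "0 < c"
  obtains C where "0 < C"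
    "\<And>(u :: 'a \<Rightarrow> real) g K \<sigma> r x.
      \<lbrakk>u \<in> borel_measurable lebesgue; \<And>y. 0 \<le> u y; 0 < K;
       \<And>y t. 0 < t \<Longrightarrow> ball_mass (\<lambda>y. u y powr p) y t \<le> ennreal (K powr p * t powr l);
       \<And>y. 0 \<le> g y; \<And>y. ennreal (g y) \<le> ennreal c * layer_potential \<alpha> u y;
       0 < \<sigma>; 0 < r;
       \<And>y t. y \<in> ball x r \<Longrightarrow> r \<le> t \<Longrightarrow> ball_mass (\<lambda>y. u y powr p) y t \<le> ennreal (\<sigma> * t ^ DIM('a))\<rbrakk> \<Longrightarrow>
      ball_mass (\<lambda>y. g y powr q) x r \<le> ennreal (C * K powr (q - p) * \<sigma> * r ^ DIM('a))"
proof -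
  define H where "H = (1 / \<alpha> + (unit_ball_vol DIM('a) + 1) / ((real DIM('a) - l) / p - \<alpha>)) powr q"
  obtain C where C: "0 < C"
    "\<And>(u :: 'a \<Rightarrow> real) \<sigma> r x.
      \<lbrakk>u \<in> borel_measurable lebesgue; \<And>y. 0 \<le> u y; 0 < \<sigma>; 0 < r;
       \<And>y t. y \<in> ball x r \<Longrightarrow> r \<le> t \<Longrightarrow> ball_mass (\<lambda>y. u y powr p) y t \<le> ennreal (\<sigma> * t ^ DIM('a))\<rbrakk> \<Longrightarrow>
      (\<integral>\<^sup>+ y\<in>ball x r. ennreal_powr (maximal_function u y) p \<partial>lebesgue) \<le> ennreal (C * \<sigma> *
          r ^ DIM('a))"
    by (rule maximal_function_local_bound[OF p(1), where 'a = 'a]) blast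
  have "0 < (real DIM('a) - l) / p - \<alpha>" using p \<alpha> l by (simp add: field_simps)
  then have "0 < 1 / \<alpha> + (unit_ball_vol DIM('a) + 1) / ((real DIM('a) - l) / p - \<alpha>)"
    using \<alpha> by (intro add_pos_nonneg) auto
  then have H: "0 < H" by (simp add: H_def)
  show thesis
  proof
    show "0 < c powr q * H * C" using H c C(1) by simp
    fix u :: "'a \<Rightarrow> real" and g K \<sigma> r x
    assume um[measurable]: "u \<in> borel_measurable lebesgue" and u: "\<And>y. 0 \<le> u y" and K: "0 < K"
      and J: "\<And>y t. 0 < t \<Longrightarrow> ball_mass (\<lambda>y. u y powr p) y t \<le> ennreal (K powr p * t powr l)"
      and g: "\<And>y. 0 \<le> g y" "\<And>y. ennreal (g y) \<le> ennreal c * layer_potential \<alpha> u y"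
      and \<sigma>: "0 < \<sigma>" and r: "0 < r"
      and loc: "\<And>y t. y \<in> ball x r \<Longrightarrow> r \<le> t \<Longrightarrow> ball_mass (\<lambda>y. u y powr p) y t \<le> ennreal (\<sigma> *
          t ^ DIM('a))"
    have [measurable]: "maximal_function u \<in> borel_measurable lebesgue"
      using borel_measurable_maximal_function[of u] by (auto intro: measurable_completion)
    have pw: "ennreal (g y powr q) \<le> ennreal (c powr q * H * K powr (q - p)) *
        ennreal_powr (maximal_function u y) p" for y
    proof -
      \<comment> \<open>\<open>g y / c\<close> lies below the potential itself, hence is an
        admissible value in Hedberg's inequality.\<close>
      have "ennreal (g y / c) = ennreal (1 / c) * ennreal (g y)"
        using c g(1) by (simp add: ennreal_mult''[symmetric])
      also have "\<dots> \<le> ennreal (1 / c) * (ennreal c * layer_potential \<alpha> u y)"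
        by (intro mult_left_mono g(2)) auto
      also have "\<dots> = layer_potential \<alpha> u y"
        using c by (simp add: mult.assoc[symmetric] ennreal_mult''[symmetric])
      finally have "ennreal ((g y / c) powr q) \<le> ennreal (H * K powr (q - p)) *
          ennreal_powr (maximal_function u y) p"
        unfolding H_def using c g(1) by (intro hedberg_pointwise[OF um u \<alpha> l p q K J]) auto
      then have "ennreal (c powr q) * ennreal ((g y / c) powr q) \<le>
          ennreal (c powr q) * (ennreal (H * K powr (q - p)) *
              ennreal_powr (maximal_function u y) p)"
        by (intro mult_left_mono) auto
      moreover have "ennreal (c powr q) * ennreal ((g y / c) powr q) = ennreal (g y powr q)"
        using c g(1)[of y] by (simp add: ennreal_mult'[symmetric] powr_divide)
      moreover have "ennreal (c powr q) * ennreal (H * K powr (q - p)) = ennreal (c powr q * H *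
          K powr (q - p))"
        by (subst ennreal_mult'[symmetric]) (simp_all add: mult.assoc)
      ultimately show ?thesis by (simp add: mult.assoc[symmetric])
    qed
    have "ball_mass (\<lambda>y. g y powr q) x r \<le> (\<integral>\<^sup>+ y. ennreal (c powr q * H * K powr (q - p)) *
        (ennreal_powr (maximal_function u y) p * indicator (ball x r) y) \<partial>lebesgue)"
      unfolding ball_mass_def using pw by (intro nn_integral_mono) (auto simp: indicator_def)
    also have "\<dots> = ennreal (c powr q * H * K powr (q - p)) *
        (\<integral>\<^sup>+ y\<in>ball x r. ennreal_powr (maximal_function u y) p \<partial>lebesgue)"
      by (rule nn_integral_cmult) measurable
    also have "\<dots> \<le> ennreal (c powr q * H * K powr (q - p)) * ennreal (C * \<sigma> * r ^ DIM('a))"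
      by (intro mult_left_mono C(2) um u \<sigma> r loc) auto
    also have "\<dots> = ennreal (c powr q * H * C * K powr (q - p) * \<sigma> * r ^ DIM('a))"
      using H by (subst ennreal_mult'[symmetric]) (simp_all add: mult_ac)
    finally show "ball_mass (\<lambda>y. g y powr q) x r \<le> ennreal (c powr q * H * C * K powr (q - p) * \<sigma> *
        r ^ DIM('a))" .
  qed
qed

text \<open>The \<open>p\<close>-th power of the maximal function is integrable on every ball, so
  the maximal function is finite almost everywhere; at such a point, splitting the potential at
  radius 1 bounds it.\<close>

lemma layer_potential_finite_AE:
  fixes u :: "'a::euclidean_space \<Rightarrow> real"
  assumes um[measurable]: "u \<in> borel_measurable lebesgue" and u: "\<And>y. 0 \<le> u y"
    and \<alpha>: "0 < \<alpha>" and l: "l < real DIM('a)" and p: "1 < p" "p < (real DIM('a) - l) / \<alpha>"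
    and K: "0 < K" and J: "\<And>y t. 0 < t \<Longrightarrow> ball_mass (\<lambda>y. u y powr p) y t \<le> ennreal (K powr p *
        t powr l)"
  shows "AE x in lebesgue. layer_potential \<alpha> u x < \<infinity>"
proof -
  let ?n = "DIM('a)"
  have [measurable]: "maximal_function u \<in> borel_measurable lebesgue"
    using borel_measurable_maximal_function[of u] by (auto intro: measurable_completion)
  obtain C where C: "0 < C"
    "\<And>(u :: 'a \<Rightarrow> real) \<sigma> r x.
      \<lbrakk>u \<in> borel_measurable lebesgue; \<And>y. 0 \<le> u y; 0 < \<sigma>; 0 < r;
       \<And>y t. y \<in> ball x r \<Longrightarrow> r \<le> t \<Longrightarrow> ball_mass (\<lambda>y. u y powr p) y t \<le> ennreal (\<sigma> * t ^ ?n)\<rbrakk> \<Longrightarrow>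
      (\<integral>\<^sup>+ y\<in>ball x r. ennreal_powr (maximal_function u y) p \<partial>lebesgue) \<le> ennreal (C * \<sigma> * r ^ ?n)"
    by (rule maximal_function_local_bound[OF p(1), where 'a = 'a]) blast
  \<comment> \<open>Countably many balls exhaust the space; \<open>Suc\<close> keeps their radii
    positive.\<close>
  have "AE x in lebesgue. x \<in> ball 0 (real (Suc N)) \<longrightarrow> maximal_function u x \<noteq> \<infinity>" for N
  proof -
    let ?r = "real (Suc N)"
    have "ball_mass (\<lambda>y. u y powr p) y t \<le> ennreal (K powr p * ?r powr (l - real ?n) * t ^ ?n)"
        if "?r \<le> t" for y t
    proof -
      have t: "0 < t" using that by simp
      have "t powr (l - real ?n) \<le> ?r powr (l - real ?n)"
        using that l by (intro powr_mono2') auto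
      then have "K powr p * t powr l \<le> K powr p * ?r powr (l - real ?n) * t ^ ?n"
        unfolding powr_split_dim[OF t, of l ?n] using t by
            (simp add: mult.assoc mult_left_mono mult_right_mono)
      then show ?thesis using J[OF t, of y] by (meson ennreal_leI order.trans)
    qed
    then have "(\<integral>\<^sup>+ y\<in>ball 0 ?r. ennreal_powr (maximal_function u y) p \<partial>lebesgue) \<le>
        ennreal (C * (K powr p * ?r powr (l - real ?n)) * ?r ^ ?n)"
      using K by (intro C(2) um u) auto
    then have "(\<integral>\<^sup>+ y\<in>ball 0 ?r. ennreal_powr (maximal_function u y) p \<partial>lebesgue) \<noteq> \<infinity>"
      by (auto simp: top_unique)
    then have "AE x in lebesgue. ennreal_powr (maximal_function u x) p *
        indicator (ball 0 ?r) x \<noteq> \<infinity>"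
      by (intro nn_integral_noteq_infinite) measurable
    then show ?thesis
      by eventually_elim (auto simp: ennreal_powr_def)
  qed
  then have "AE x in lebesgue. \<forall>N. x \<in> ball 0 (real (Suc N)) \<longrightarrow> maximal_function u x \<noteq> \<infinity>"
    unfolding AE_all_countable by (rule allI)
  then show ?thesis
  proof eventually_elim
    fix x assume *: "\<forall>N. x \<in> ball 0 (real (Suc N)) \<longrightarrow> maximal_function u x \<noteq> \<infinity>"
    obtain N where "norm x < real N" using reals_Archimedean2 by blast
    then have "x \<in> ball 0 (real (Suc N))" by simp
    with * have "maximal_function u x \<noteq> \<infinity>" by blast
    then obtain m where m: "0 \<le> m" "maximal_function u x = ennreal m"
      by (cases "maximal_function u x") auto
    define \<beta> where "\<beta> = (real ?n - l) / p - \<alpha>"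
    have \<beta>: "0 < \<beta>" using p \<alpha> l by (simp add: \<beta>_def field_simps)
    let ?c = "(unit_ball_vol (real ?n) + 1) * K"
    have near: "ball_mass u x t \<le> ennreal (m * t ^ ?n)" if t: "0 < t" for t
      using maximal_function_upper[OF t, of u x] m by (simp add: ennreal_mult')
    have far: "ball_mass u x t \<le> ennreal (?c * t powr (- \<alpha> - \<beta>) * t ^ ?n)" if t: "0 < t" for t
    proof -
      have "- \<alpha> - \<beta> = - ((real ?n - l) / p)" by (simp add: \<beta>_def)
      then show ?thesis
        using ball_mass_le_of_morrey_bound[OF um u _ K t J[OF t]] p by (simp only:)
    qed
    have "layer_potential \<alpha> u x \<le> ennreal (m * 1 powr \<alpha> / \<alpha> + ?c * 1 powr (- \<beta>) / \<beta>)"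
      by (rule layer_potential_le_split[OF \<alpha> \<beta> zero_less_one m(1) _ near far]) (use K in auto)
    also have "\<dots> < \<infinity>" by simp
    finally show "layer_potential \<alpha> u x < \<infinity>" .
  qed
qed

text \<open>The vanishing conditions in terms of \<open>w = |f|^p\<close>. In the last one, the truncation to the
  complement of \<open>ball 0 N\<close> is replaced by taking the centres far away.\<close>

definition mass_vanishes_at_0 :: "real \<Rightarrow> ('a::euclidean_space \<Rightarrow> real) \<Rightarrow> bool" where
  "mass_vanishes_at_0 l w \<longleftrightarrow>
     (\<forall>\<epsilon>>0. \<exists>\<delta>>0. \<forall>r x. 0 < r \<longrightarrow> r < \<delta> \<longrightarrow> ball_mass w x r \<le> ennreal (\<epsilon> * r powr l))"

definition mass_vanishes_at_infinity :: "real \<Rightarrow> ('a::euclidean_space \<Rightarrow> real) \<Rightarrow> bool" where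
  "mass_vanishes_at_infinity l w \<longleftrightarrow>
     (\<forall>\<epsilon>>0. \<exists>R>0. \<forall>r x. R \<le> r \<longrightarrow> ball_mass w x r \<le> ennreal (\<epsilon> * r powr l))"

definition mass_vanishes_far_away :: "('a::euclidean_space \<Rightarrow> real) \<Rightarrow> bool" where
  "mass_vanishes_far_away w \<longleftrightarrow>
     (\<forall>\<epsilon>>0. \<exists>N. \<forall>x. N \<le> norm x \<longrightarrow> ball_mass w x 1 \<le> ennreal \<epsilon>)"

text \<open>One cover of a ball about the origin is translated to every centre, so the number of
  unit balls does not depend on \<open>x\<close>.\<close>

lemma ball_mass_le_sum_unit_balls:
  fixes w :: "'a::euclidean_space \<Rightarrow> real"
  assumes [measurable]: "w \<in> borel_measurable lebesgue"
    and Z: "finite Z" "ball 0 R \<subseteq> (\<Union>z\<in>Z. ball z 1)"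
  shows "ball_mass w x R \<le> (\<Sum>z\<in>Z. ball_mass w (x + z) 1)"
proof -
  have "ball_mass w x R \<le> (\<integral>\<^sup>+ y. (\<Sum>z\<in>Z. ennreal (w y) * indicator (ball (x + z) 1) y) \<partial>lebesgue)"
    unfolding ball_mass_def
  proof (rule nn_integral_mono)
    fix y
    show "ennreal (w y) * indicator (ball x R) y \<le> (\<Sum>z\<in>Z. ennreal (w y) * indicator (ball (x +
        z) 1) y)"
    proof (cases "y \<in> ball x R")
      case True
      then have "y - x \<in> ball 0 R" by (simp add: dist_norm norm_minus_commute)
      then obtain z where z: "z \<in> Z" "y - x \<in> ball z 1" using Z by blast
      then have "y \<in> ball (x + z) 1" by (simp add: dist_norm algebra_simps)
      then have "ennreal (w y) * indicator (ball x R) y \<le> ennreal (w y) * indicator (ball (x +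
          z) 1) y"
        by (simp add: indicator_def)
      also have "\<dots> \<le> (\<Sum>z\<in>Z. ennreal (w y) * indicator (ball (x + z) 1) y)"
        using z Z by (intro member_le_sum) auto
      finally show ?thesis .
    qed simp
  qed
  also have "\<dots> = (\<Sum>z\<in>Z. ball_mass w (x + z) 1)"
    unfolding ball_mass_def by (rule nn_integral_sum) measurable
  finally show ?thesis .
qed

text \<open>The condition speaks of radius 1 only; compactness of \<open>cball 0 R\<close> extends
  it to any fixed radius.\<close>

lemma mass_far_away_uniform:
  fixes w :: "'a::euclidean_space \<Rightarrow> real"
  assumes w: "w \<in> borel_measurable lebesgue" "mass_vanishes_far_away w" and \<epsilon>: "0 < \<epsilon>"
  obtains N where "\<And>x. N \<le> norm x \<Longrightarrow> ball_mass w x R \<le> ennreal \<epsilon>"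
proof -
  have "compact (cball (0::'a) R)" by simp
  then obtain Z where Z: "finite Z" "cball (0::'a) R \<subseteq> (\<Union>z\<in>Z. ball z 1)"
    using compact_imp_seq_compact seq_compact_imp_totally_bounded zero_less_one by metis
  then obtain B where B: "\<And>z. z \<in> Z \<Longrightarrow> norm z \<le> B"
    by (meson bounded_iff finite_imp_bounded)
  \<comment> \<open>The added 1 keeps the divisor positive even if \<open>Z\<close> is
    empty.\<close>
  define k where "k = real (card Z) + 1"
  have k: "0 < k" by (simp add: k_def)
  obtain N where N: "\<And>x. N \<le> norm x \<Longrightarrow> ball_mass w x 1 \<le> ennreal (\<epsilon> / k)"
    using w(2) \<epsilon> k unfolding mass_vanishes_far_away_def by (meson divide_pos_pos)
  show thesis
  proof
    \<comment> \<open>The margin \<open>B\<close> keeps all translated centres \<open>x + z\<close>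
      at norm at least \<open>N\<close>.\<close>
    fix x :: 'a assume x: "N + B \<le> norm x"
    have "ball_mass w x R \<le> (\<Sum>z\<in>Z. ball_mass w (x + z) 1)"
      using Z by (intro ball_mass_le_sum_unit_balls w(1))
          (auto intro: order.trans[OF ball_subset_cball])
    also have "\<dots> \<le> (\<Sum>z\<in>Z. ennreal (\<epsilon> / k))"
    proof (intro sum_mono N)
      fix z assume "z \<in> Z"
      then show "N \<le> norm (x + z)"
        using B[of z] x norm_triangle_ineq2[of x "- z"] by simp
    qed
    also have "\<dots> = ennreal (real (card Z) * (\<epsilon> / k))"
      using \<epsilon> k by (simp add: ennreal_of_nat_eq_real_of_nat ennreal_mult'[symmetric])
    also have "\<dots> \<le> ennreal \<epsilon>"
    proof (rule ennreal_leI)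
      have "real (card Z) * \<epsilon> \<le> k * \<epsilon>" using \<epsilon> by (simp add: k_def)
      then show "real (card Z) * (\<epsilon> / k) \<le> \<epsilon>" using k by (simp add: field_simps)
    qed
    finally show "ball_mass w x R \<le> ennreal \<epsilon>" .
  qed
qed

text \<open>All four conclusions use the local bound with
  \<open>\<sigma> = \<epsilon> * r powr (l - n)\<close>, which turns \<open>\<sigma> * r ^ n\<close>
  into \<open>\<epsilon> * r powr l\<close>. They differ in how small \<open>\<epsilon>\<close> can
  be taken: \<open>K powr p\<close> in general, arbitrarily small in the regimes of the vanishing
  conditions.\<close>

lemma potential_mass_bounds:
  fixes \<alpha> l p q c :: real
  assumes \<alpha>: "0 < \<alpha>" and l: "l < real DIM('a::euclidean_space)"
    and p: "1 < p" "p < (real DIM('a) - l) / \<alpha>"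
    and q: "1 / q = 1 / p - \<alpha> / (real DIM('a) - l)" and c: "0 < c"
  obtains C where "0 < C"
    "\<And>(u :: 'a \<Rightarrow> real) g K.
      \<lbrakk>u \<in> borel_measurable lebesgue; \<And>y. 0 \<le> u y; 0 < K;
       \<And>y t. 0 < t \<Longrightarrow> ball_mass (\<lambda>y. u y powr p) y t \<le> ennreal (K powr p * t powr l);
       \<And>y. 0 \<le> g y; \<And>y. ennreal (g y) \<le> ennreal c * layer_potential \<alpha> u y\<rbrakk> \<Longrightarrow>
      (\<forall>x r. 0 < r \<longrightarrow> ball_mass (\<lambda>y. g y powr q) x r \<le> ennreal (C * K powr q * r powr l)) \<and>
      (mass_vanishes_at_0 l (\<lambda>y. u y powr p) \<longrightarrow> mass_vanishes_at_0 l (\<lambda>y. g y powr q)) \<and>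
      (mass_vanishes_at_infinity l (\<lambda>y. u y powr p) \<longrightarrow>
          mass_vanishes_at_infinity l (\<lambda>y. g y powr q)) \<and>
      (mass_vanishes_far_away (\<lambda>y. u y powr p) \<longrightarrow> mass_vanishes_far_away (\<lambda>y. g y powr q))"
proof -
  let ?n = "DIM('a)"
  obtain C where C: "0 < C"
    "\<And>(u :: 'a \<Rightarrow> real) g K \<sigma> r x.
      \<lbrakk>u \<in> borel_measurable lebesgue; \<And>y. 0 \<le> u y; 0 < K;
       \<And>y t. 0 < t \<Longrightarrow> ball_mass (\<lambda>y. u y powr p) y t \<le> ennreal (K powr p * t powr l);
       \<And>y. 0 \<le> g y; \<And>y. ennreal (g y) \<le> ennreal c * layer_potential \<alpha> u y;
       0 < \<sigma>; 0 < r;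
       \<And>y t. y \<in> ball x r \<Longrightarrow> r \<le> t \<Longrightarrow> ball_mass (\<lambda>y. u y powr p) y t \<le> ennreal (\<sigma> * t ^ ?n)\<rbrakk> \<Longrightarrow>
      ball_mass (\<lambda>y. g y powr q) x r \<le> ennreal (C * K powr (q - p) * \<sigma> * r ^ ?n)"
    by (rule potential_local_bound[OF \<alpha> l p q c]) blast
  show thesis
  proof
    show "0 < C" by fact
    fix u :: "'a \<Rightarrow> real" and g K
    assume um[measurable]: "u \<in> borel_measurable lebesgue" and u: "\<And>y. 0 \<le> u y" and K: "0 < K"
      and J: "\<And>y t. 0 < t \<Longrightarrow> ball_mass (\<lambda>y. u y powr p) y t \<le> ennreal (K powr p * t powr l)"
      and g: "\<And>y. 0 \<le> g y" "\<And>y. ennreal (g y) \<le> ennreal c * layer_potential \<alpha> u y"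
    note local = C(2)[OF um u K J g]
    let ?U = "ball_mass (\<lambda>y. u y powr p)" and ?G = "ball_mass (\<lambda>y. g y powr q)"
    let ?D = "C * K powr (q - p)"
    have D: "0 < ?D" using C(1) K by simp
    have bound: "?G x r \<le> ennreal (?D * \<epsilon> * r powr l)"
      if r: "0 < r" and \<epsilon>: "0 < \<epsilon>"
        and le: "\<And>y t. y \<in> ball x r \<Longrightarrow> r \<le> t \<Longrightarrow> ?U y t \<le> ennreal (\<epsilon> * r powr (l - real ?n) * t ^ ?n)"
      for x r \<epsilon>
    proof -
      have "?G x r \<le> ennreal (?D * (\<epsilon> * r powr (l - real ?n)) * r ^ ?n)"
        by (rule local) (use r \<epsilon> le in auto)
      then show ?thesis
        unfolding powr_split_dim[OF r, of l ?n] by (simp add: mult.assoc)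
    qed
    \<comment> \<open>Since \<open>l < n\<close>, a Morrey bound at radius \<open>t\<close> implies
      the density bound belonging to any smaller radius \<open>s\<close>.\<close>
    have decr: "\<epsilon> * t powr l \<le> \<epsilon> * s powr (l - real ?n) * t ^ ?n" if "0 < s" "s \<le> t" "0 \<le> \<epsilon>"
        for s t \<epsilon>
    proof -
      have t: "0 < t" using that by linarith
      have "t powr (l - real ?n) \<le> s powr (l - real ?n)"
        using that l by (intro powr_mono2') auto
      then show ?thesis
        unfolding powr_split_dim[OF t, of l ?n] using t that by
            (simp add: mult.assoc mult_left_mono mult_right_mono)
    qed
    \<comment> \<open>Each vanishing claim is proved with \<open>\<eta> = \<epsilon> / ?D\<close>,
      so that the constant of \<open>bound\<close> cancels.\<close>
    have rescale: "?D * (\<epsilon> / ?D) = \<epsilon>" for \<epsilon>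
      using D by (simp only: times_divide_eq_right nonzero_mult_div_cancel_left
          less_imp_neq[symmetric] not_False_eq_True)
    show "(\<forall>x r. 0 < r \<longrightarrow> ?G x r \<le> ennreal (C * K powr q * r powr l)) \<and>
      (mass_vanishes_at_0 l (\<lambda>y. u y powr p) \<longrightarrow> mass_vanishes_at_0 l (\<lambda>y. g y powr q)) \<and>
      (mass_vanishes_at_infinity l (\<lambda>y. u y powr p) \<longrightarrow>
          mass_vanishes_at_infinity l (\<lambda>y. g y powr q)) \<and>
      (mass_vanishes_far_away (\<lambda>y. u y powr p) \<longrightarrow> mass_vanishes_far_away (\<lambda>y. g y powr q))"
    proof (intro conjI allI impI)
      fix x r assume r: "(0::real) < r"
      have "?G x r \<le> ennreal (?D * K powr p * r powr l)"
      proof (rule bound[OF r])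
        fix y t assume "r \<le> t"
        then have "K powr p * t powr l \<le> K powr p * r powr (l - real ?n) * t ^ ?n"
          using r by (intro decr) auto
        then show "?U y t \<le> ennreal (K powr p * r powr (l - real ?n) * t ^ ?n)"
          using J[of t y] r \<open>r \<le> t\<close> by (meson ennreal_leI order.trans less_le_trans)
      qed (use K in simp)
      also have "?D * K powr p = C * K powr q"
        using K by (simp add: powr_add[symmetric])
      finally show "?G x r \<le> ennreal (C * K powr q * r powr l)" .
    next
      assume V: "mass_vanishes_at_0 l (\<lambda>y. u y powr p)"
      show "mass_vanishes_at_0 l (\<lambda>y. g y powr q)"
        unfolding mass_vanishes_at_0_def
      proof (intro allI impI)
        fix \<epsilon> :: real assume \<epsilon>: "0 < \<epsilon>"
        define \<eta> where "\<eta> = \<epsilon> / ?D"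
        have \<eta>: "0 < \<eta>" using \<epsilon> D by (simp add: \<eta>_def)
        obtain \<delta> where \<delta>: "0 < \<delta>" "\<And>r x. 0 < r \<Longrightarrow> r < \<delta> \<Longrightarrow> ?U x r \<le> ennreal (\<eta> * r powr l)"
          using V \<eta> unfolding mass_vanishes_at_0_def by metis
        \<comment> \<open>For \<open>t \<ge> \<delta>\<close> only the density
          \<open>K powr p * \<delta> powr (l - n)\<close> of the Morrey bound is available.
          \<open>\<rho>\<close> is the radius at which it equals
          \<open>\<eta> * \<rho> powr (l - n)\<close>; for \<open>r < \<rho>\<close> the permitted
          density is larger still, the exponent being negative.\<close>
        define \<rho> where "\<rho> = (K powr p * \<delta> powr (l - real ?n) / \<eta>) powr (1 / (l - real ?n))"
        have \<rho>: "0 < \<rho>" using K \<delta> \<eta> by (simp add: \<rho>_def)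
        have \<rho>_eq: "\<eta> * \<rho> powr (l - real ?n) = K powr p * \<delta> powr (l - real ?n)"
          using K \<delta> \<eta> l by (simp add: \<rho>_def powr_powr)
        show "\<exists>\<delta>>0. \<forall>r x. 0 < r \<longrightarrow> r < \<delta> \<longrightarrow> ?G x r \<le> ennreal (\<epsilon> * r powr l)"
        proof (intro exI[of _ \<rho>] conjI allI impI \<rho>)
          fix r x assume r: "0 < r" "r < \<rho>"
          have "?G x r \<le> ennreal (?D * \<eta> * r powr l)"
          proof (rule bound[OF r(1) \<eta>])
            fix y t assume t: "r \<le> t"
            show "?U y t \<le> ennreal (\<eta> * r powr (l - real ?n) * t ^ ?n)"
            proof (cases "t < \<delta>")
              case True
              have "?U y t \<le> ennreal (\<eta> * t powr l)" using r t True by (intro \<delta>(2)) auto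
              also have "\<dots> \<le> ennreal (\<eta> * r powr (l - real ?n) * t ^ ?n)"
                using r t \<eta> by (intro ennreal_leI decr) auto
              finally show ?thesis .
            next
              case False
              have "?U y t \<le> ennreal (K powr p * t powr l)" using r t by (intro J) auto
              also have "\<dots> \<le> ennreal (K powr p * \<delta> powr (l - real ?n) * t ^ ?n)"
                using False \<delta> by (intro ennreal_leI decr) auto
              also have "\<dots> \<le> ennreal (\<eta> * r powr (l - real ?n) * t ^ ?n)"
              proof (intro ennreal_leI mult_right_mono)
                have "\<rho> powr (l - real ?n) \<le> r powr (l - real ?n)"
                  using r l by (intro powr_mono2') auto
                then show "K powr p * \<delta> powr (l - real ?n) \<le> \<eta> * r powr (l - real ?n)"
                  unfolding \<rho>_eq[symmetric] using \<eta> by simp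
              qed (use r t in auto)
              finally show ?thesis .
            qed
          qed
          then show "?G x r \<le> ennreal (\<epsilon> * r powr l)" by (simp only: \<eta>_def rescale)
        qed
      qed
    next
      assume V: "mass_vanishes_at_infinity l (\<lambda>y. u y powr p)"
      show "mass_vanishes_at_infinity l (\<lambda>y. g y powr q)"
        unfolding mass_vanishes_at_infinity_def
      proof (intro allI impI)
        fix \<epsilon> :: real assume \<epsilon>: "0 < \<epsilon>"
        define \<eta> where "\<eta> = \<epsilon> / ?D"
        have \<eta>: "0 < \<eta>" using \<epsilon> D by (simp add: \<eta>_def)
        obtain R where R: "0 < R" "\<And>r x. R \<le> r \<Longrightarrow> ?U x r \<le> ennreal (\<eta> * r powr l)"
          using V \<eta> unfolding mass_vanishes_at_infinity_def by metis
        \<comment> \<open>Only radii \<open>t \<ge> r \<ge> R\<close> occur, so the threshold found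
          for \<open>u\<close> serves for \<open>g\<close> unchanged.\<close>
        show "\<exists>R>0. \<forall>r x. R \<le> r \<longrightarrow> ?G x r \<le> ennreal (\<epsilon> * r powr l)"
        proof (intro exI[of _ R] conjI allI impI R(1))
          fix r x assume r: "R \<le> r"
          then have r0: "0 < r" using R by linarith
          have "?G x r \<le> ennreal (?D * \<eta> * r powr l)"
          proof (rule bound[OF r0 \<eta>])
            fix y t assume t: "r \<le> t"
            have "?U y t \<le> ennreal (\<eta> * t powr l)" using r t by (intro R(2)) auto
            also have "\<dots> \<le> ennreal (\<eta> * r powr (l - real ?n) * t ^ ?n)"
              using r0 t \<eta> by (intro ennreal_leI decr) auto
            finally show "?U y t \<le> ennreal (\<eta> * r powr (l - real ?n) * t ^ ?n)" .
          qed
          then show "?G x r \<le> ennreal (\<epsilon> * r powr l)" by (simp only: \<eta>_def rescale)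
        qed
      qed
    next
      assume V: "mass_vanishes_far_away (\<lambda>y. u y powr p)"
      show "mass_vanishes_far_away (\<lambda>y. g y powr q)"
        unfolding mass_vanishes_far_away_def
      proof (intro allI impI)
        fix \<epsilon> :: real assume \<epsilon>: "0 < \<epsilon>"
        define \<eta> where "\<eta> = \<epsilon> / ?D"
        have \<eta>: "0 < \<eta>" using \<epsilon> D by (simp add: \<eta>_def)
        \<comment> \<open>From radius \<open>R\<close> on, the Morrey bound alone gives density at
          most \<open>\<eta>\<close>. Smaller balls lie in balls of radius \<open>R\<close>, whose
          mass is small far away.\<close>
        define R where "R = (\<eta> / K powr p) powr (1 / (l - real ?n))"
        have R: "0 < R" using K \<eta> by (simp add: R_def)
        have R_eq: "K powr p * R powr (l - real ?n) = \<eta>"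
          using K \<eta> l by (simp add: R_def powr_powr)
        obtain N where N: "\<And>x. N \<le> norm x \<Longrightarrow> ?U x R \<le> ennreal \<eta>"
          by (rule mass_far_away_uniform[OF _ V \<eta>]) (measurable, blast)
        show "\<exists>N. \<forall>x. N \<le> norm x \<longrightarrow> ?G x 1 \<le> ennreal \<epsilon>"
        \<comment> \<open>The shift by 1 accounts for centres \<open>y\<close> in the unit ball
          about \<open>x\<close>.\<close>
        proof (intro exI[of _ "N + 1"] allI impI)
          fix x :: 'a assume x: "N + 1 \<le> norm x"
          have "?G x 1 \<le> ennreal (?D * \<eta> * 1 powr l)"
          proof (rule bound[OF zero_less_one \<eta>])
            fix y t assume y: "y \<in> ball x 1" and t: "(1::real) \<le> t"
            have "N \<le> norm y"
              using x y norm_triangle_ineq2[of x "x - y"] by (simp add: dist_norm)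
            show "?U y t \<le> ennreal (\<eta> * 1 powr (l - real ?n) * t ^ ?n)"
            proof (cases "R \<le> t")
              case True
              have "?U y t \<le> ennreal (K powr p * t powr l)" using t by (intro J) auto
              also have "\<dots> \<le> ennreal (K powr p * R powr (l - real ?n) * t ^ ?n)"
                using True R by (intro ennreal_leI decr) auto
              finally show ?thesis by (simp add: R_eq)
            next
              case False
              have "?U y t \<le> ?U y R"
                using False by (intro ball_mass_mono subset_ball) auto
              also have "\<dots> \<le> ennreal \<eta>" by (intro N) fact
              also have "\<dots> \<le> ennreal (\<eta> * 1 powr (l - real ?n) * t ^ ?n)"
                using t \<eta> by (intro ennreal_leI) (simp add: one_le_power)
              finally show ?thesis .
            qed
          qed
          then show "?G x 1 \<le> ennreal \<epsilon>" by (simp only: \<eta>_def rescale powr_one_eq_one mult_1_right)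
        qed
      qed
    qed
  qed
qed

section \<open>Vanishing Morrey spaces in terms of masses\<close>

lemma locally_p_integrable_ball:
  fixes f :: "real ^ 'n \<Rightarrow> 'b::real_normed_vector"
  assumes "locally_p_integrable p f"
  shows "set_integrable lebesgue (ball x r) (\<lambda>y. norm (f y) powr p)"
proof -
  have "set_integrable lebesgue (cball x r) (\<lambda>y. norm (f y) powr p)"
    by (rule conjunct2[OF assms[unfolded locally_p_integrable_def], rule_format, OF compact_cball])
  then show ?thesis
    by (rule set_integrable_subset[OF _ ball_in_sets_lebesgue ball_subset_cball])
qed

text \<open>Local integrability rules out the default value 0 of the Bochner integral, so the real
  modular and the extended mass carry the same information.\<close>

lemma ball_mass_eq_modular:
  fixes f :: "real ^ 'n \<Rightarrow> 'b::real_normed_vector"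
  assumes "locally_p_integrable p f" "0 < r"
  shows "ball_mass (\<lambda>y. norm (f y) powr p) x r = ennreal (r powr l * morrey_modular p l f x r)"
proof -
  note locally_p_integrable_ball[OF assms(1), of x r]
  then have "ennreal (LINT y:ball x r|lebesgue. norm (f y) powr p) =
      (\<integral>\<^sup>+ y. ennreal (indicator (ball x r) y *\<^sub>R norm (f y) powr p) \<partial>lebesgue)"
    unfolding set_lebesgue_integral_def set_integrable_def
    by (intro nn_integral_eq_integral[symmetric]) auto
  also have "\<dots> = ball_mass (\<lambda>y. norm (f y) powr p) x r"
    unfolding ball_mass_def by (intro nn_integral_cong) (auto simp: indicator_def)
  finally show ?thesis
    using assms(2) by (simp add: morrey_modular_def)
qed

lemma morrey_modular_nonneg: "0 \<le> morrey_modular p l f x r"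
  unfolding morrey_modular_def set_lebesgue_integral_def by (auto intro!: integral_nonneg_AE)

lemma morrey_modular_le_iff:
  fixes f :: "real ^ 'n \<Rightarrow> 'b::real_normed_vector"
  assumes "locally_p_integrable p f" "0 < r" "0 \<le> e"
  shows "morrey_modular p l f x r \<le> e \<longleftrightarrow> ball_mass (\<lambda>y. norm (f y) powr p) x r \<le> ennreal (e *
      r powr l)"
proof -
  have "ball_mass (\<lambda>y. norm (f y) powr p) x r \<le> ennreal (e * r powr l) \<longleftrightarrow>
      r powr l * morrey_modular p l f x r \<le> e * r powr l"
    unfolding ball_mass_eq_modular[OF assms(1,2), of x l] using assms by (simp add: ennreal_le_iff)
  also have "\<dots> \<longleftrightarrow> morrey_modular p l f x r \<le> e"
    using assms by (simp add: mult.commute)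
  finally show ?thesis ..
qed

lemma morrey_space_mass_le:
  fixes f :: "real ^ 'n \<Rightarrow> 'b::real_normed_vector"
  assumes f: "f \<in> morrey_space p l" and p: "0 < p" and r: "0 < r" and K: "morrey_norm p l f \<le> K"
  shows "ball_mass (\<lambda>y. norm (f y) powr p) x r \<le> ennreal (K powr p * r powr l)"
proof -
  have loc: "locally_p_integrable p f"
    and bdd: "bdd_above ((\<lambda>(x, r). morrey_modular p l f x r powr (1 / p)) ` (UNIV \<times> {0<..}))"
    using f by (auto simp: morrey_space_def)
  have "morrey_modular p l f x r powr (1 / p) \<le> morrey_norm p l f"
    unfolding morrey_norm_def using r cSUP_upper[OF _ bdd, of "(x, r)"] by simp
  then have le: "morrey_modular p l f x r powr (1 / p) \<le> K" using K by linarith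
  have "(morrey_modular p l f x r powr (1 / p)) powr p \<le> K powr p"
    using le p by (intro powr_mono2) auto
  then have "morrey_modular p l f x r \<le> K powr p"
    using p morrey_modular_nonneg[of p l f x r] by (simp add: powr_powr)
  then show ?thesis
    using loc r by (simp add: morrey_modular_le_iff)
qed

lemma morrey_norm_nonneg:
  fixes f :: "real ^ 'n \<Rightarrow> 'b::real_normed_vector"
  assumes f: "f \<in> morrey_space p l"
  shows "0 \<le> morrey_norm p l f"
proof -
  have bdd: "bdd_above ((\<lambda>(x, r). morrey_modular p l f x r powr (1 / p)) ` (UNIV \<times> {0<..}))"
    using f by (auto simp: morrey_space_def)
  have "morrey_modular p l f 0 1 powr (1 / p) \<le> morrey_norm p l f"
    unfolding morrey_norm_def using cSUP_upper[OF _ bdd, of "(0, 1)"] by simp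
  then show ?thesis by (meson order.trans powr_ge_zero)
qed

text \<open>Compact sets lie in balls, so finite masses already give local integrability; one family
  of mass bounds yields both membership and the norm estimate.\<close>

lemma morrey_spaceI:
  fixes f :: "real ^ 'n \<Rightarrow> 'b::real_normed_vector"
  assumes [measurable]: "f \<in> borel_measurable lebesgue" and p: "0 < p" and K: "0 \<le> K"
    and le: "\<And>x r. 0 < r \<Longrightarrow> ball_mass (\<lambda>y. norm (f y) powr p) x r \<le> ennreal (K powr p * r powr l)"
  shows "f \<in> morrey_space p l" "morrey_norm p l f \<le> K"
proof -
  have nf [measurable]: "(\<lambda>y. norm (f y) powr p) \<in> borel_measurable lebesgue"
    by (intro powr_real_measurable borel_measurable_const measurable_compose[OF assms(1)
        borel_measurable_norm])
  have loc: "locally_p_integrable p f"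
    unfolding locally_p_integrable_def
  proof (intro conjI allI impI)
    fix S :: "(real ^ 'n) set" assume S: "compact S"
    then obtain r where r: "0 < r" "S \<subseteq> ball 0 r"
      using compact_imp_bounded bounded_subset_ballD by metis
    have [measurable]: "S \<in> sets lebesgue" using S by (simp add: borel_compact)
    have "(\<integral>\<^sup>+ y. ennreal (norm (indicat_real S y *\<^sub>R norm (f y) powr p)) \<partial>lebesgue) \<le>
        ball_mass (\<lambda>y. norm (f y) powr p) 0 r"
      unfolding ball_mass_def using r by (intro nn_integral_mono) (auto simp: indicator_def)
    also have "\<dots> < \<infinity>" using le[OF r(1), of 0] by (auto simp: top_unique less_top[symmetric])
    finally show "set_integrable lebesgue S (\<lambda>y. norm (f y) powr p)"
      unfolding set_integrable_def
      by (intro integrableI_bounded borel_measurable_scaleR[OF borel_measurable_indicator nf]) auto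
  qed measurable
  have ub: "morrey_modular p l f x r powr (1 / p) \<le> K" if "0 < r" for x r
  proof -
    have "morrey_modular p l f x r \<le> K powr p"
      using le[OF that, of x] loc that by (simp add: morrey_modular_le_iff)
    then have "morrey_modular p l f x r powr (1 / p) \<le> (K powr p) powr (1 / p)"
      using p by (intro powr_mono2 morrey_modular_nonneg) auto
    also have "\<dots> = K" using p K by (simp add: powr_powr)
    finally show ?thesis .
  qed
  then have "bdd_above ((\<lambda>(x, r). morrey_modular p l f x r powr (1 / p)) ` (UNIV \<times> {0<..}))"
    by (intro bdd_aboveI[of _ K]) auto
  with loc show "f \<in> morrey_space p l" by (simp add: morrey_space_def)
  show "morrey_norm p l f \<le> K"
    unfolding morrey_norm_def by (intro cSUP_least) (use ub in auto)
qed

text \<open>A real supremum is meaningful only for a bounded family; membership in the Morrey space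
  provides the bound at each radius.\<close>

lemma SUP_modular:
  fixes f :: "real ^ 'n \<Rightarrow> 'b::real_normed_vector"
  assumes f: "f \<in> morrey_space p l" and p: "0 < p" and r: "0 < r"
  shows "0 \<le> (SUP x. morrey_modular p l f x r)"
    and "0 \<le> e \<Longrightarrow> (SUP x. morrey_modular p l f x r) \<le> e \<longleftrightarrow>
      (\<forall>x. ball_mass (\<lambda>y. norm (f y) powr p) x r \<le> ennreal (e * r powr l))"
proof -
  have loc: "locally_p_integrable p f" using f by (auto simp: morrey_space_def)
  have "morrey_modular p l f x r \<le> morrey_norm p l f powr p" for x
    using morrey_space_mass_le[OF f p r order.refl, of x] loc r by (simp add: morrey_modular_le_iff)
  then have bdd: "bdd_above (range (\<lambda>x. morrey_modular p l f x r))"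
    by (intro bdd_aboveI) auto
  have "0 \<le> morrey_modular p l f 0 r" by (rule morrey_modular_nonneg)
  also have "\<dots> \<le> (SUP x. morrey_modular p l f x r)" by (intro cSUP_upper bdd) auto
  finally show "0 \<le> (SUP x. morrey_modular p l f x r)" .
  show "(SUP x. morrey_modular p l f x r) \<le> e \<longleftrightarrow>
      (\<forall>x. ball_mass (\<lambda>y. norm (f y) powr p) x r \<le> ennreal (e * r powr l))" if "0 \<le> e"
    using that loc r by (simp add: cSUP_le_iff[OF _ bdd] flip: morrey_modular_le_iff)
qed

lemma tendsto_zero_iff_eventually_le:
  fixes F :: "'a \<Rightarrow> real"
  assumes nn: "eventually (\<lambda>r. 0 \<le> F r) A"
  shows "(F \<longlongrightarrow> 0) A \<longleftrightarrow> (\<forall>\<epsilon>>0. eventually (\<lambda>r. F r \<le> \<epsilon>) A)"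
proof
  assume lim: "(F \<longlongrightarrow> 0) A"
  show "\<forall>\<epsilon>>0. eventually (\<lambda>r. F r \<le> \<epsilon>) A"
  proof (intro allI impI)
    fix \<epsilon> :: real assume "0 < \<epsilon>"
    then have "eventually (\<lambda>r. F r < \<epsilon>) A" by (rule order_tendstoD(2)[OF lim])
    then show "eventually (\<lambda>r. F r \<le> \<epsilon>) A" by (rule eventually_mono) (rule less_imp_le)
  qed
next
  assume *: "\<forall>\<epsilon>>0. eventually (\<lambda>r. F r \<le> \<epsilon>) A"
  show "(F \<longlongrightarrow> 0) A"
  proof (rule tendstoI)
    fix e :: real assume e: "0 < e"
    then have "0 < e / 2" by (rule half_gt_zero)
    then have le: "eventually (\<lambda>r. F r \<le> e / 2) A" by (rule *[rule_format])
    show "eventually (\<lambda>r. dist (F r) 0 < e) A"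
      using nn le
    proof (rule eventually_elim2)
      fix r assume "0 \<le> F r" "F r \<le> e / 2"
      then show "dist (F r) 0 < e" using e by (simp only: dist_real_def)
    qed
  qed
qed

section \<open>The three limits as conditions on masses\<close>

lemma vanishing_at_0_iff:
  fixes f :: "real ^ 'n \<Rightarrow> 'b::real_normed_vector"
  assumes f: "f \<in> morrey_space p l" and p: "0 < p"
  shows "vanishing_at_0 p l f \<longleftrightarrow> mass_vanishes_at_0 l (\<lambda>y. norm (f y) powr p)"
proof -
  have pos: "\<forall>\<^sub>F r in at_right 0. 0 < (r::real)" by (simp add: eventually_at_right_less)
  have nn: "\<forall>\<^sub>F r in at_right 0. 0 \<le> (SUP x. morrey_modular p l f x r)"
    using pos by eventually_elim (rule SUP_modular(1)[OF f p])
  have "vanishing_at_0 p l f \<longleftrightarrow> (\<forall>\<epsilon>>0. \<exists>\<delta>>0. \<forall>r>0. r < \<delta> \<longrightarrow> (SUP x. morrey_modular p l f x r) \<le> \<epsilon>)"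
    unfolding vanishing_at_0_def tendsto_zero_iff_eventually_le[OF nn] eventually_at_right_field
        by auto
  also have "\<dots> \<longleftrightarrow> mass_vanishes_at_0 l (\<lambda>y. norm (f y) powr p)"
    unfolding mass_vanishes_at_0_def by (simp add: SUP_modular(2)[OF f p])
  finally show ?thesis .
qed

lemma vanishing_at_infinity_iff:
  fixes f :: "real ^ 'n \<Rightarrow> 'b::real_normed_vector"
  assumes f: "f \<in> morrey_space p l" and p: "0 < p"
  shows "vanishing_at_infinity p l f \<longleftrightarrow> mass_vanishes_at_infinity l (\<lambda>y. norm (f y) powr p)"
proof -
  have nn: "\<forall>\<^sub>F r in at_top. 0 \<le> (SUP x. morrey_modular p l f x r)"
    using eventually_gt_at_top[of 0] by eventually_elim (rule SUP_modular(1)[OF f p])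
  have "vanishing_at_infinity p l f \<longleftrightarrow> (\<forall>\<epsilon>>0. \<exists>R>0. \<forall>r\<ge>R. (SUP x. morrey_modular p l f x r) \<le> \<epsilon>)"
  proof -
    \<comment> \<open>A positive threshold costs nothing at infinity, and the supremum is under
      control for positive radii.\<close>
    have "(\<exists>R. \<forall>r\<ge>R. P r) \<longleftrightarrow> (\<exists>R>0. \<forall>r\<ge>R. P r)" for P :: "real \<Rightarrow> bool"
    proof
      assume "\<exists>R. \<forall>r\<ge>R. P r"
      then obtain R where "\<forall>r\<ge>R. P r" ..
      then show "\<exists>R>0. \<forall>r\<ge>R. P r" by (intro exI[of _ "max R 1"]) auto
    qed blast
    then show ?thesis
      unfolding vanishing_at_infinity_def tendsto_zero_iff_eventually_le[OF nn]
          eventually_at_top_linorder by simp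
  qed
  also have "\<dots> \<longleftrightarrow> mass_vanishes_at_infinity l (\<lambda>y. norm (f y) powr p)"
  proof -
    have "(\<forall>r\<ge>R. (SUP x. morrey_modular p l f x r) \<le> \<epsilon>) \<longleftrightarrow>
        (\<forall>r x. R \<le> r \<longrightarrow> ball_mass (\<lambda>y. norm (f y) powr p) x r \<le> ennreal (\<epsilon> * r powr l))"
      if "0 < R" "0 < \<epsilon>" for R \<epsilon>
      using that SUP_modular(2)[OF f p] by (meson less_le_trans less_imp_le)
    then show ?thesis
      unfolding mass_vanishes_at_infinity_def by (simp cong: conj_cong)
  qed
  finally show ?thesis .
qed

text \<open>The truncated mass \<open>S N x\<close> is the full unit-ball mass for
  \<open>norm x \<ge> N + 1\<close> and 0 for \<open>norm x \<le> N - 1\<close>. Hence truncating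
  and moving the centre away agree up to a shift of the threshold.\<close>

lemma vanishing_star_iff:
  fixes f :: "real ^ 'n \<Rightarrow> 'b::real_normed_vector"
  assumes f: "f \<in> morrey_space p l" and p: "0 < p"
  shows "vanishing_star p f \<longleftrightarrow> mass_vanishes_far_away (\<lambda>y. norm (f y) powr p)"
proof -
  let ?w = "\<lambda>y. norm (f y) powr p"
  have fm: "f \<in> borel_measurable lebesgue" and loc: "locally_p_integrable p f"
    using f by (auto simp: morrey_space_def locally_p_integrable_def)
  have nf: "(\<lambda>y. norm (f y) powr p) \<in> borel_measurable lebesgue"
    by (intro powr_real_measurable borel_measurable_const measurable_compose[OF fm
        borel_measurable_norm])
  define S where "S N x = (LINT y:ball x 1|lebesgue. ?w y * indicat_real (- ball 0 N) y)" for N x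
  have S0: "0 \<le> S N x" for N x
    unfolding S_def set_lebesgue_integral_def by (auto intro!: integral_nonneg_AE)
  have S_eq: "ennreal (S N x) = (\<integral>\<^sup>+ y. ennreal (?w y * indicat_real (- ball 0 N) y) *
      indicator (ball x 1) y \<partial>lebesgue)" for N x
  proof -
    note locally_p_integrable_ball[OF loc, of x 1]
    then have "integrable lebesgue (\<lambda>y. indicat_real (ball x 1) y *\<^sub>R (?w y *
        indicat_real (- ball 0 N) y))"
      unfolding set_integrable_def
    proof (rule Bochner_Integration.integrable_bound)
      have "- ball (0 :: real ^ 'n) N \<in> sets borel"
        by (intro borel_closed closed_Compl open_ball)
      then have far: "- ball (0 :: real ^ 'n) N \<in> sets lebesgue"
        by (intro sets_completionI_sets) (simp only: sets_lborel)
      show "(\<lambda>y. indicat_real (ball x 1) y *\<^sub>R (?w y *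
          indicat_real (- ball 0 N) y)) \<in> borel_measurable lebesgue"
        by (rule borel_measurable_scaleR[OF borel_measurable_indicator[OF ball_in_sets_lebesgue]
              borel_measurable_times[OF nf borel_measurable_indicator[OF far]]])
    qed (auto simp: indicator_def)
    then have "ennreal (S N x) = (\<integral>\<^sup>+ y. ennreal (indicat_real (ball x 1) y *\<^sub>R (?w y *
        indicat_real (- ball 0 N) y)) \<partial>lebesgue)"
      unfolding S_def set_lebesgue_integral_def by (intro nn_integral_eq_integral[symmetric]) auto
    also have "\<dots> = (\<integral>\<^sup>+ y. ennreal (?w y * indicat_real (- ball 0 N) y) *
        indicator (ball x 1) y \<partial>lebesgue)"
      by (intro nn_integral_cong) (auto simp: indicator_def)
    finally show ?thesis .
  qed
  have S_le: "ennreal (S N x) \<le> ball_mass ?w x 1" for N x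
    unfolding S_eq ball_mass_def by (intro nn_integral_mono) (auto simp: indicator_def)
  have S_far: "ennreal (S N x) = ball_mass ?w x 1" if "N + 1 \<le> norm x" for N x
    unfolding S_eq ball_mass_def
  proof (intro nn_integral_cong)
    fix y
    have "y \<notin> ball 0 N" if "y \<in> ball x 1"
      using that \<open>N + 1 \<le> norm x\<close> norm_triangle_ineq2[of x "x - y"] by (simp add: dist_norm)
    then show "ennreal (?w y * indicat_real (- ball 0 N) y) * indicator (ball x 1) y =
        ennreal (?w y) * indicator (ball x 1) y"
      by (auto simp: indicator_def)
  qed
  have S_near: "S N x = 0" if "norm x \<le> N - 1" for N x
  proof -
    have "y \<in> ball 0 N" if "y \<in> ball x 1" for y
      using that \<open>norm x \<le> N - 1\<close> norm_triangle_ineq2[of y x] by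
          (simp add: dist_norm norm_minus_commute)
    then have "indicat_real (ball x 1) y *\<^sub>R (?w y * indicat_real (- ball 0 N) y) = 0" for y
      by (auto simp: indicator_def)
    then show ?thesis unfolding S_def set_lebesgue_integral_def by
        (simp only: Bochner_Integration.integral_zero)
  qed
  have "S N x \<le> morrey_norm p l f powr p" for N x
  proof -
    have "ennreal (S N x) \<le> ennreal (morrey_norm p l f powr p * 1 powr l)"
      by (rule order.trans[OF S_le morrey_space_mass_le[OF f p zero_less_one order.refl]])
    then show ?thesis by (simp add: ennreal_le_iff)
  qed
  then have bdd: "bdd_above (range (S N))" for N
    by (intro bdd_aboveI) auto
  have "0 \<le> (SUP x. S N x)" for N
    using S0[of N 0] cSUP_upper[OF _ bdd, of 0 N] by (auto intro: order.trans)
  then have nn: "\<forall>\<^sub>F N in at_top. 0 \<le> (SUP x. S N x)" by simp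
  have star: "vanishing_star p f \<longleftrightarrow> (\<forall>\<epsilon>>0. \<exists>M. \<forall>N\<ge>M. \<forall>x. S N x \<le> \<epsilon>)"
    unfolding vanishing_star_def S_def[symmetric] tendsto_zero_iff_eventually_le[OF nn]
        eventually_at_top_linorder
    by (simp add: cSUP_le_iff[OF _ bdd])
  show ?thesis
  proof
    assume "vanishing_star p f"
    then have *: "\<forall>\<epsilon>>0. \<exists>M. \<forall>N\<ge>M. \<forall>x. S N x \<le> \<epsilon>" by (simp add: star)
    show "mass_vanishes_far_away ?w"
      unfolding mass_vanishes_far_away_def
    proof (intro allI impI)
      fix \<epsilon> :: real assume "0 < \<epsilon>"
      then obtain M where M: "\<And>x. S M x \<le> \<epsilon>" using * by blast
      show "\<exists>N. \<forall>x. N \<le> norm x \<longrightarrow> ball_mass ?w x 1 \<le> ennreal \<epsilon>"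
        using M S_far[of M] by (metis ennreal_leI)
    qed
  next
    assume V: "mass_vanishes_far_away ?w"
    show "vanishing_star p f"
      unfolding star
    proof (intro allI impI)
      fix \<epsilon> :: real assume \<epsilon>: "0 < \<epsilon>"
      then obtain M where M: "\<And>x. M \<le> norm x \<Longrightarrow> ball_mass ?w x 1 \<le> ennreal \<epsilon>"
        using V unfolding mass_vanishes_far_away_def by metis
      show "\<exists>M. \<forall>N\<ge>M. \<forall>x. S N x \<le> \<epsilon>"
      \<comment> \<open>For \<open>N \<ge> M + 1\<close>, a centre with \<open>norm x < M\<close>
        has its unit ball inside \<open>ball 0 N\<close>, so only centres with
        \<open>M \<le> norm x\<close> contribute.\<close>
      proof (intro exI[of _ "M + 1"] allI impI)
        fix N x assume N: "M + 1 \<le> N"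
        show "S N x \<le> \<epsilon>"
        proof (cases "M \<le> norm x")
          case True
          then have "ennreal (S N x) \<le> ennreal \<epsilon>" using M S_le order.trans by blast
          then show ?thesis using \<epsilon> by (simp add: ennreal_le_iff)
        next
          case False
          then have "S N x = 0" using N by (intro S_near) linarith
          then show ?thesis using \<epsilon> by simp
        qed
      qed
    qed
  qed
qed

section \<open>The four operators\<close>

lemma borel_measurable_ident_lebesgue: "(\<lambda>x. x) \<in> borel_measurable lebesgue"
  by (rule measurable_completion) simp

lemma borel_measurable_norm_lebesgue: "norm \<in> borel_measurable lebesgue"
  by (rule measurable_completion) simp

lemma borel_measurable_dist_lebesgue: "dist x \<in> borel_measurable lebesgue"
  by (rule measurable_completion) simp

text \<open>Tonelli: for \<open>t > 0\<close>, a point \<open>y\<close> lies in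
  \<open>ball x t\<close> exactly when \<open>t > dist x y\<close>, so exchanging the integrals
  exposes the kernel.\<close>

lemma layer_potential_kernel:
  fixes u :: "'a::euclidean_space \<Rightarrow> real"
  assumes [measurable]: "u \<in> borel_measurable lebesgue"
  shows "layer_potential \<alpha> u x = (\<integral>\<^sup>+ y. \<integral>\<^sup>+ t. ennreal (u y) *
    (ennreal (t powr (\<alpha> - real DIM('a) - 1)) * indicator {t. 0 < t \<and>
        dist x y < t} t) \<partial>lborel \<partial>lebesgue)"
proof -
  note borel_measurable_dist_lebesgue [measurable]
  have "layer_potential \<alpha> u x = (\<integral>\<^sup>+ t. \<integral>\<^sup>+ y. ennreal (u y) *
      (ennreal (t powr (\<alpha> - real DIM('a) - 1)) * indicator {t. 0 < t \<and>
          dist x y < t} t) \<partial>lebesgue \<partial>lborel)"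
    unfolding layer_potential_def
  proof (rule nn_integral_cong)
    fix t :: real
    have "ennreal (t powr (\<alpha> - real DIM('a) - 1)) * ball_mass u x t * indicator {0<..} t =
        (\<integral>\<^sup>+ y. (ennreal (t powr (\<alpha> - real DIM('a) - 1)) * indicator {0<..} t) * (ennreal (u y) *
            indicator (ball x t) y) \<partial>lebesgue)"
      unfolding ball_mass_def by (subst nn_integral_cmult) (measurable, simp add: mult_ac)
    also have "\<dots> = (\<integral>\<^sup>+ y. ennreal (u y) *
      (ennreal (t powr (\<alpha> - real DIM('a) - 1)) * indicator {t. 0 < t \<and> dist x y < t} t) \<partial>lebesgue)"
      by (intro nn_integral_cong) (auto simp: indicator_def mult_ac)
    finally show "ennreal (t powr (\<alpha> - real DIM('a) - 1)) * ball_mass u x t * indicator {0<..} t =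
        \<dots>" .
  qed
  also have "\<dots> = (\<integral>\<^sup>+ y. \<integral>\<^sup>+ t. ennreal (u y) *
    (ennreal (t powr (\<alpha> - real DIM('a) - 1)) * indicator {t. 0 < t \<and>
        dist x y < t} t) \<partial>lborel \<partial>lebesgue)"
    by (rule lebesgue_lborel.Fubini') measurable
  finally show ?thesis .
qed

text \<open>\<open>s powr (\<alpha> - n)\<close> is \<open>n - \<alpha>\<close> times the integral
  of \<open>t powr (\<alpha> - n - 1)\<close> over \<open>t \<ge> s\<close>, a range inside that of
  the kernel up to one point. The free radius \<open>s\<close> serves all operators:
  \<open>dist x y\<close> for Riesz, the radius of the ball for the maximal operator,
  \<open>2 * norm x\<close> and \<open>2 * norm y\<close> for the Hardy operators.\<close>

lemma nn_integral_le_layer_potential: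
  fixes u :: "'a::euclidean_space \<Rightarrow> real"
  assumes [measurable]: "u \<in> borel_measurable lebesgue" and u: "\<And>y. 0 \<le>
      u y" and \<alpha>: "\<alpha> < real DIM('a)"
    and h: "\<And>y. h y \<le> 0 \<or> (\<exists>s>0. dist x y \<le> s \<and> h y \<le> u y * s powr (\<alpha> - real DIM('a)))"
  shows "(\<integral>\<^sup>+ y. ennreal (h y) \<partial>lebesgue) \<le> ennreal (real DIM('a) - \<alpha>) * layer_potential \<alpha> u x"
proof -
  let ?b = "real DIM('a) - \<alpha>"
  have b: "0 < ?b" using \<alpha> by simp
  have kernel: "(\<lambda>t. ennreal (t powr (\<alpha> - real DIM('a) - 1)) * indicator {t. 0 < t \<and>
      dist x y < t} t) \<in> borel_measurable lborel" for y
    by measurable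
  note borel_measurable_dist_lebesgue [measurable]
  let ?k = "\<lambda>y. \<integral>\<^sup>+ t. ennreal (u y) *
    (ennreal (t powr (\<alpha> - real DIM('a) - 1)) * indicator {t. 0 < t \<and> dist x y < t} t) \<partial>lborel"
  have "ennreal (h y) \<le> ennreal ?b * ?k y" for y
  proof (cases "h y \<le> 0")
    case False
    then obtain s where s: "0 < s" "dist x y \<le> s" "h y \<le> u y * s powr (\<alpha> - real DIM('a))"
      using h[of y] by blast
    \<comment> \<open>The kernel asks for \<open>dist x y < t\<close> strictly, which
      \<open>{s..}\<close> can violate only at \<open>t = s\<close>.\<close>
    have ne: "AE t in lborel. t \<noteq> s" by (rule AE_lborel_singleton)
    have "ennreal (h y) \<le> ennreal (?b * (u y * (s powr (- ?b) / ?b)))"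
      using s b by (intro ennreal_leI) simp
    also have "\<dots> = ennreal ?b * (ennreal (u y) * ennreal (s powr (- ?b) / ?b))"
      using u b by (simp only: ennreal_mult' less_imp_le)
    also have "ennreal (s powr (- ?b) / ?b) = (\<integral>\<^sup>+ t. ennreal (t powr (- ?b - 1)) *
        indicator {s..} t \<partial>lborel)"
      by (rule nn_integral_powr_above[OF b s(1), symmetric])
    also have "\<dots> \<le> (\<integral>\<^sup>+ t. ennreal (t powr (\<alpha> - real DIM('a) - 1)) * indicator {t. 0 < t \<and>
        dist x y < t} t \<partial>lborel)"
      by (rule nn_integral_mono_AE, rule AE_mp[OF ne]) (use s in \<open>auto simp: indicator_def\<close>)
    also have "ennreal (u y) * \<dots> = ?k y"
      by (rule nn_integral_cmult[OF kernel, symmetric])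
    finally show ?thesis by (simp add: mult_left_mono)
  qed (simp add: ennreal_neg)
  then have "(\<integral>\<^sup>+ y. ennreal (h y) \<partial>lebesgue) \<le> (\<integral>\<^sup>+ y. ennreal ?b * ?k y \<partial>lebesgue)"
    by (intro nn_integral_mono)
  also have "\<dots> = ennreal ?b * layer_potential \<alpha> u x"
    unfolding layer_potential_kernel[OF assms(1)] by (rule nn_integral_cmult) measurable
  finally show ?thesis .
qed

text \<open>For a non-integrable \<open>f\<close> the left side is 0 by convention, so the operators
  can be dominated at every point.\<close>

lemma norm_integral_le_nn_integral:
  fixes f :: "'a \<Rightarrow> 'b::{banach, second_countable_topology}"
  shows "ennreal (norm (\<integral>x. f x \<partial>M)) \<le> (\<integral>\<^sup>+x. ennreal (norm (f x)) \<partial>M)"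
  by (cases "integrable M f") (auto simp: integral_norm_bound_ennreal not_integrable_integral_eq)

text \<open>\<open>T\<close> enters through three properties: measurability of \<open>T f\<close>,
  domination by the potential, and meaningfulness off the origin wherever the potential is finite.
  This treats the sublinear maximal operator together with the linear ones.\<close>

lemma dominated_operator_bounded:
  fixes T :: "(real ^ 'n \<Rightarrow> 'b::{real_normed_field, banach, second_countable_topology}) \<Rightarrow> real ^ 'n
      \<Rightarrow> 'b"
  assumes \<alpha>: "0 < \<alpha>" and l: "l < real CARD('n)"
    and p: "1 < p" "p < (real CARD('n) - l) / \<alpha>"
    and q: "1 / q = 1 / p - \<alpha> / (real CARD('n) - l)" and c: "0 < c"
    and meas: "\<And>f. f \<in> borel_measurable lebesgue \<Longrightarrow> T f \<in> borel_measurable lebesgue"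
    and dom: "\<And>f x. f \<in> borel_measurable lebesgue \<Longrightarrow>
      ennreal (norm (T f x)) \<le> ennreal c * layer_potential \<alpha> (\<lambda>y. norm (f y)) x"
    and defd: "\<And>f x. f \<in> borel_measurable lebesgue \<Longrightarrow> x \<noteq> 0 \<Longrightarrow>
      layer_potential \<alpha> (\<lambda>y. norm (f y)) x < \<infinity> \<Longrightarrow> T_defined f x"
  shows "(\<forall>f \<in> vanishing_morrey_space p l.
            (AE x in lebesgue. T_defined f x) \<and> T f \<in> vanishing_morrey_space q l) \<and>
         (\<exists>C. \<forall>f \<in> vanishing_morrey_space p l. morrey_norm q l (T f) \<le> C * morrey_norm p l f)"
proof -
  let ?n = "real DIM(real ^ 'n)"
  have dim: "?n = real CARD('n)" by simp
  note l' = l[folded dim] and p' = p[folded dim] and q' = q[folded dim]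
  have "0 < 1 / q" unfolding q using p \<alpha> l by (simp add: field_simps)
  then have q0: "0 < q" by simp
  have p0: "0 < p" using p by simp
  obtain C where C: "0 < C"
    "\<And>(u :: real ^ 'n \<Rightarrow> real) g K.
      \<lbrakk>u \<in> borel_measurable lebesgue; \<And>y. 0 \<le> u y; 0 < K;
       \<And>y t. 0 < t \<Longrightarrow> ball_mass (\<lambda>y. u y powr p) y t \<le> ennreal (K powr p * t powr l);
       \<And>y. 0 \<le> g y; \<And>y. ennreal (g y) \<le> ennreal c * layer_potential \<alpha> u y\<rbrakk> \<Longrightarrow>
      (\<forall>x r. 0 < r \<longrightarrow> ball_mass (\<lambda>y. g y powr q) x r \<le> ennreal (C * K powr q * r powr l)) \<and>
      (mass_vanishes_at_0 l (\<lambda>y. u y powr p) \<longrightarrow> mass_vanishes_at_0 l (\<lambda>y. g y powr q)) \<and>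
      (mass_vanishes_at_infinity l (\<lambda>y. u y powr p) \<longrightarrow>
          mass_vanishes_at_infinity l (\<lambda>y. g y powr q)) \<and>
      (mass_vanishes_far_away (\<lambda>y. u y powr p) \<longrightarrow> mass_vanishes_far_away (\<lambda>y. g y powr q))"
    by (rule potential_mass_bounds[OF \<alpha> l' p' q' c]) blast
  \<comment> \<open>The \<open>q\<close>-th root turns the constant for masses of
    \<open>q\<close>-th powers into one for norms.\<close>
  define D where "D = C powr (1 / q)"
  have D: "0 < D" using C(1) by (simp add: D_def)
  have D_q: "(D * K) powr q = C * K powr q" if "0 < K" for K
    using that C(1) q0 by (simp add: D_def powr_mult powr_powr)
  have main: "(AE x in lebesgue. T_defined f x) \<and> T f \<in> vanishing_morrey_space q l \<and>
      morrey_norm q l (T f) \<le> D * morrey_norm p l f"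
    if f: "f \<in> vanishing_morrey_space p l" for f
  proof -
    let ?u = "\<lambda>y. norm (f y)" and ?N = "morrey_norm p l f"
    have fM: "f \<in> morrey_space p l" using f by (simp add: vanishing_morrey_space_def)
    then have fm: "f \<in> borel_measurable lebesgue"
      by (simp add: morrey_space_def locally_p_integrable_def)
    have um: "?u \<in> borel_measurable lebesgue"
      by (rule measurable_compose[OF fm borel_measurable_norm])
    have N: "0 \<le> ?N" by (rule morrey_norm_nonneg[OF fM])
    \<comment> \<open>The mass estimates ask for \<open>K > 0\<close>, but the norm may be 0. Hence
      every \<open>K\<close> strictly above the norm is used, and the norm itself is reached by
      \<open>field_le_epsilon\<close>.\<close>
    have J: "ball_mass (\<lambda>y. ?u y powr p) y t \<le> ennreal (K powr p * t powr l)" if "?N < K" "0 < t"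
        for K y t
      using that by (intro morrey_space_mass_le[OF fM p0]) auto
    have Tm: "T f \<in> borel_measurable lebesgue" by (rule meas[OF fm])
    note bounds = C(2)[OF um norm_ge_zero _ J norm_ge_zero dom[OF fm]]
    have TfK: "T f \<in> morrey_space q l" "morrey_norm q l (T f) \<le> D * K" if K: "?N < K" for K
    proof -
      have K0: "0 < K" using N K by linarith
      have le: "ball_mass (\<lambda>y. norm (T f y) powr q) x r \<le> ennreal ((D * K) powr q * r powr l)"
          if "0 < r" for x r
        unfolding D_q[OF K0] using bounds[OF K0 K] that by blast
      show "T f \<in> morrey_space q l" "morrey_norm q l (T f) \<le> D * K"
        using K0 D by (intro morrey_spaceI[OF Tm q0 _ le]; simp)+
    qed
    have N1: "?N < ?N + 1" "0 < ?N + 1" using N by auto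
    note TM = TfK(1)[OF N1(1)]
    have "T f \<in> vanishing_morrey_space q l"
      using f bounds[OF N1(2) N1(1)] TM fM
      by (simp add: vanishing_morrey_space_def vanishing_at_0_iff[OF _ p0] vanishing_at_0_iff[OF _
          q0]
          vanishing_at_infinity_iff[OF _ p0] vanishing_at_infinity_iff[OF _ q0]
          vanishing_star_iff[OF _ p0] vanishing_star_iff[OF _ q0])
    moreover have "morrey_norm q l (T f) \<le> D * ?N"
    proof (rule field_le_epsilon)
      fix e :: real assume "0 < e"
      then have "morrey_norm q l (T f) \<le> D * (?N + e / D)" using D by (intro TfK(2)) simp
      then show "morrey_norm q l (T f) \<le> D * ?N + e" using D by (simp add: algebra_simps)
    qed
    moreover have "AE x in lebesgue. T_defined f x"
    proof -
      have "AE x in lebesgue. layer_potential \<alpha> ?u x < \<infinity>"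
        by (rule layer_potential_finite_AE[OF um norm_ge_zero \<alpha> l' p' N1(2) J[OF N1(1)]])
      \<comment> \<open>The origin is discarded: the prefactors of the Hardy operators are 0 there
        and give no control of the integrals.\<close>
      moreover have "AE x in lebesgue. x \<noteq> (0 :: real ^ 'n)"
        by (rule AE_completion) (rule AE_lborel_singleton)
      ultimately show ?thesis
        by eventually_elim (rule defd[OF fm])
    qed
    ultimately show ?thesis by blast
  qed
  then show ?thesis by blast
qed

section \<open>Domination, measurability and meaningfulness of each operator\<close>

lemma measurable_norm_fun [measurable]:
  "f \<in> borel_measurable M \<Longrightarrow> (\<lambda>x. norm (f x)) \<in> borel_measurable M"
  for f :: "'a \<Rightarrow> 'b::real_normed_vector"
  by (rule measurable_compose[OF _ borel_measurable_norm])

lemma norm_riesz_integrand: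
  fixes f :: "real ^ 'n \<Rightarrow> 'b::real_normed_vector"
  shows "norm (f y /\<^sub>R norm (x - y) powr (real CARD('n) - \<alpha>)) = norm (f y) *
      dist x y powr (\<alpha> - real CARD('n))"
proof -
  have "inverse (norm (x - y) powr (real CARD('n) - \<alpha>)) = norm (x - y) powr - (real CARD('n) - \<alpha>)"
    by (rule powr_minus[symmetric])
  then show ?thesis by (simp add: dist_norm mult.commute)
qed

lemma riesz_nn_integral_le:
  fixes f :: "real ^ 'n \<Rightarrow> 'b::{real_normed_field, banach, second_countable_topology}"
  assumes "f \<in> borel_measurable lebesgue" and \<alpha>: "\<alpha> < real CARD('n)"
  shows "(\<integral>\<^sup>+ y. ennreal (norm (f y /\<^sub>R norm (x - y) powr (real CARD('n) - \<alpha>))) \<partial>lebesgue) \<le>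
    ennreal (real CARD('n) - \<alpha>) * layer_potential \<alpha> (\<lambda>y. norm (f y)) x"
proof -
  have "norm (f y /\<^sub>R norm (x - y) powr (real CARD('n) - \<alpha>)) \<le> 0 \<or>
    (\<exists>s>0. dist x y \<le> s \<and> norm (f y /\<^sub>R norm (x - y) powr (real CARD('n) - \<alpha>))
      \<le> norm (f y) * s powr (\<alpha> - real DIM(real ^ 'n)))" for y
    \<comment> \<open>At \<open>y = x\<close> the integrand is 0 because
      \<open>0 powr a = 0\<close>; elsewhere the radius is \<open>dist x y\<close> itself.\<close>
    unfolding norm_riesz_integrand by (cases "x = y") (auto intro!: exI[of _ "dist x y"])
  then show ?thesis
    using nn_integral_le_layer_potential[of "\<lambda>y. norm (f y)" \<alpha>
        "\<lambda>y. norm (f y /\<^sub>R norm (x - y) powr (real CARD('n) - \<alpha>))" x] assms by simp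
qed

lemma riesz_potential_bounded:
  fixes f :: "real ^ 'n \<Rightarrow> 'b::{real_normed_field, banach, second_countable_topology}"
  assumes fm[measurable]: "f \<in> borel_measurable lebesgue" and \<alpha>: "\<alpha> < real CARD('n)"
  shows "riesz_potential \<alpha> f \<in> borel_measurable lebesgue"
    and "ennreal (norm (riesz_potential \<alpha> f x)) \<le>
      ennreal (real CARD('n) - \<alpha>) * layer_potential \<alpha> (\<lambda>y. norm (f y)) x"
    and "layer_potential \<alpha> (\<lambda>y. norm (f y)) x < \<infinity> \<Longrightarrow> riesz_potential_defined \<alpha> f x"
proof -
  note borel_measurable_ident_lebesgue [measurable]
  show "riesz_potential \<alpha> f \<in> borel_measurable lebesgue"
    unfolding riesz_potential_def[abs_def] by measurable
  show "ennreal (norm (riesz_potential \<alpha> f x)) \<le>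
      ennreal (real CARD('n) - \<alpha>) * layer_potential \<alpha> (\<lambda>y. norm (f y)) x"
    unfolding riesz_potential_def
    by (rule order.trans[OF norm_integral_le_nn_integral riesz_nn_integral_le[OF assms]])
  assume fin: "layer_potential \<alpha> (\<lambda>y. norm (f y)) x < \<infinity>"
  show "riesz_potential_defined \<alpha> f x"
    unfolding riesz_potential_defined_def
  proof (rule integrableI_bounded)
    show "(\<lambda>y. f y /\<^sub>R norm (x - y) powr (real CARD('n) - \<alpha>)) \<in> borel_measurable lebesgue"
        by measurable
    have "ennreal (real CARD('n) - \<alpha>) * layer_potential \<alpha> (\<lambda>y. norm (f y)) x < \<infinity>"
      using fin by (simp add: ennreal_mult_less_top)
    then show "(\<integral>\<^sup>+ y. ennreal (norm (f y /\<^sub>R norm (x - y) powr (real CARD('n) - \<alpha>))) \<partial>lebesgue) <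
        \<infinity>"
      by (rule le_less_trans[OF riesz_nn_integral_le[OF assms]])
  qed
qed

text \<open>Up to a power of \<open>unit_ball_vol\<close>, the quotient at radius \<open>t\<close>
  integrates \<open>norm (f y)\<close> against \<open>t powr (\<alpha> - n)\<close> over
  \<open>dist x y < t\<close>, so \<open>t\<close> is the comparison radius.\<close>

lemma frac_maximal_ennreal_le:
  fixes f :: "real ^ 'n \<Rightarrow> 'b::{real_normed_field, banach, second_countable_topology}"
  assumes fm[measurable]: "f \<in> borel_measurable lebesgue" and \<alpha>: "\<alpha> < real CARD('n)"
  shows "frac_maximal_ennreal \<alpha> f x \<le>
    ennreal (unit_ball_vol (real CARD('n)) powr (\<alpha> / real CARD('n) - 1) * (real CARD('n) - \<alpha>)) *
    layer_potential \<alpha> (\<lambda>y. norm (f y)) x"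
  unfolding frac_maximal_ennreal_def
proof (rule SUP_least)
  fix t :: real assume "t \<in> {0<..}"
  then have t: "0 < t" by simp
  let ?n = "real CARD('n)" and ?\<omega> = "unit_ball_vol (real CARD('n))"
  let ?u = "\<lambda>y. norm (f y)" and ?v = "measure lebesgue (ball x t) powr (1 - \<alpha> / real CARD('n))"
  have \<omega>: "0 < ?\<omega>" by simp
  have v: "?v = ?\<omega> powr (1 - \<alpha> / ?n) * t powr (?n - \<alpha>)"
  proof -
    have "measure lebesgue (ball x t) = ?\<omega> * t ^ CARD('n)"
      using t by (simp add: content_ball)
    also have "t ^ CARD('n) = t powr ?n" using t by (simp add: powr_realpow)
    finally have "measure lebesgue (ball x t) = ?\<omega> * t powr ?n" .
    moreover have "?n * (1 - \<alpha> / ?n) = ?n - \<alpha>" by (simp add: field_simps)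
    ultimately show ?thesis using t by (simp add: powr_mult powr_powr)
  qed
  have "?\<omega> \<noteq> 0" using \<omega> by linarith
  then have v0: "0 < ?v" unfolding v using t by simp
  have "ennreal (t powr (\<alpha> - ?n)) * ball_mass ?u x t =
      (\<integral>\<^sup>+ y. ennreal (t powr (\<alpha> - ?n)) * (ennreal (?u y) * indicator (ball x t) y) \<partial>lebesgue)"
    unfolding ball_mass_def by (intro nn_integral_cmult[symmetric]) measurable
  also have "\<dots> = (\<integral>\<^sup>+ y. ennreal (if dist x y < t then ?u y * t powr (\<alpha> - ?n) else 0) \<partial>lebesgue)"
    by (intro nn_integral_cong) (auto simp: indicator_def ennreal_mult' mult.commute)
  also have "\<dots> \<le> ennreal (real DIM(real ^ 'n) - \<alpha>) * layer_potential \<alpha> ?u x"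
    using fm \<alpha> t by (intro nn_integral_le_layer_potential measurable_norm_fun)
        (auto intro!: exI[of _ t])
  finally have le: "ennreal (t powr (\<alpha> - ?n)) * ball_mass ?u x t \<le> ennreal (?n - \<alpha>) *
      layer_potential \<alpha> ?u x"
    by simp
  have "ball_mass ?u x t / ennreal ?v = ennreal (1 / ?v) * ball_mass ?u x t"
    using v0 by (simp add: divide_ennreal_def inverse_ennreal mult.commute inverse_eq_divide)
  also have "1 / ?v = ?\<omega> powr (\<alpha> / ?n - 1) * t powr (\<alpha> - ?n)"
  proof -
    have "1 / (a powr b) = a powr (- b)" for a b :: real by (simp add: powr_minus_divide)
    then have "1 / ?v = ?\<omega> powr (- (1 - \<alpha> / ?n)) * t powr (- (?n - \<alpha>))"
      unfolding v by (metis divide_divide_eq_left mult_1 times_divide_eq_left times_divide_eq_right)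
    then show ?thesis by simp
  qed
  also have "ennreal (?\<omega> powr (\<alpha> / ?n - 1) * t powr (\<alpha> - ?n)) * ball_mass ?u x t =
      ennreal (?\<omega> powr (\<alpha> / ?n - 1)) * (ennreal (t powr (\<alpha> - ?n)) * ball_mass ?u x t)"
    by (simp add: ennreal_mult' mult.assoc)
  also have "\<dots> \<le> ennreal (?\<omega> powr (\<alpha> / ?n - 1)) * (ennreal (?n - \<alpha>) * layer_potential \<alpha> ?u x)"
    by (intro mult_left_mono le) auto
  also have "\<dots> = ennreal (?\<omega> powr (\<alpha> / ?n - 1) * (?n - \<alpha>)) * layer_potential \<alpha> ?u x"
    by (simp add: ennreal_mult' mult.assoc)
  finally show "(\<integral>\<^sup>+ y \<in> ball x t. ennreal (norm (f y)) \<partial>lebesgue) / ennreal ?v \<le>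
      ennreal (?\<omega> powr (\<alpha> / ?n - 1) * (?n - \<alpha>)) * layer_potential \<alpha> ?u x"
    by (simp only: ball_mass_def)
qed

lemma frac_maximal_bounded:
  fixes f :: "real ^ 'n \<Rightarrow> 'b::{real_normed_field, banach, second_countable_topology}"
  assumes fm[measurable]: "f \<in> borel_measurable lebesgue" and \<alpha>: "\<alpha> < real CARD('n)"
  shows "frac_maximal \<alpha> f \<in> borel_measurable lebesgue"
    and "ennreal (norm (frac_maximal \<alpha> f x)) \<le>
      ennreal (unit_ball_vol (real CARD('n)) powr (\<alpha> / real CARD('n) - 1) * (real CARD('n) - \<alpha>)) *
      layer_potential \<alpha> (\<lambda>y. norm (f y)) x"
    and "layer_potential \<alpha> (\<lambda>y. norm (f y)) x < \<infinity> \<Longrightarrow> frac_maximal_defined \<alpha> f x"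
proof -
  have "frac_maximal_ennreal \<alpha> f \<in> borel_measurable lebesgue"
  proof (rule measurable_completion)
    \<comment> \<open>In terms of \<open>ball_mass\<close> the superlevel sets are open, which gives
      measurability in spite of the uncountable supremum.\<close>
    have "frac_maximal_ennreal \<alpha> f = (\<lambda>x. SUP t\<in>{0<..}. ball_mass (\<lambda>y. norm (f y)) x t /
        ennreal ((unit_ball_vol (real CARD('n)) * t ^ CARD('n)) powr (1 - \<alpha> / real CARD('n))))"
      unfolding frac_maximal_ennreal_def[abs_def] ball_mass_def
      by (intro ext SUP_cong) (simp_all add: content_ball)
    also have "\<dots> \<in> borel_measurable borel"
      using fm unit_ball_vol_pos[of "real CARD('n)"]
      by (intro borel_measurable_SUP_ball_mass measurable_norm_fun) (auto simp: less_le)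
    finally show "frac_maximal_ennreal \<alpha> f \<in> borel_measurable lborel" by simp
  qed
  then show "frac_maximal \<alpha> f \<in> borel_measurable lebesgue"
    unfolding frac_maximal_def[abs_def] by measurable
  have "norm (frac_maximal \<alpha> f x) = enn2real (frac_maximal_ennreal \<alpha> f x)"
    by (simp add: frac_maximal_def)
  \<comment> \<open>Only an inequality, since \<open>enn2real\<close> sends infinity to 0.\<close>
  then have "ennreal (norm (frac_maximal \<alpha> f x)) \<le> frac_maximal_ennreal \<alpha> f x"
    by (cases "frac_maximal_ennreal \<alpha> f x") auto
  then show "ennreal (norm (frac_maximal \<alpha> f x)) \<le>
      ennreal (unit_ball_vol (real CARD('n)) powr (\<alpha> / real CARD('n) - 1) * (real CARD('n) - \<alpha>)) *
      layer_potential \<alpha> (\<lambda>y. norm (f y)) x"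
    by (rule order.trans[OF _ frac_maximal_ennreal_le[OF assms]])
  assume fin: "layer_potential \<alpha> (\<lambda>y. norm (f y)) x < \<infinity>"
  show "frac_maximal_defined \<alpha> f x"
    unfolding frac_maximal_defined_def
    by (rule le_less_trans[OF frac_maximal_ennreal_le[OF assms]])
        (use fin in \<open>simp add: ennreal_mult_less_top\<close>)
qed

lemma powr_double:
  "0 < s \<Longrightarrow> (2::real) powr (- a) * (2 * s) powr a = s powr a"
  by (simp add: powr_mult powr_minus)

text \<open>If \<open>norm y < norm x\<close> then \<open>dist x y \<le> 2 * norm x\<close>; passing
  from \<open>norm x\<close> to this radius in the kernel costs
  \<open>2 powr (n - \<alpha>)\<close>.\<close>

lemma hardy_inner_nn_integral_le:
  fixes f :: "real ^ 'n \<Rightarrow> 'b::{real_normed_field, banach, second_countable_topology}"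
  assumes fm[measurable]: "f \<in> borel_measurable lebesgue" and \<alpha>: "\<alpha> < real CARD('n)"
  shows "ennreal (norm x powr (\<alpha> - real CARD('n))) *
      (\<integral>\<^sup>+ y. ennreal (norm (indicat_real {y. norm y < norm x} y *\<^sub>R f y)) \<partial>lebesgue) \<le>
    ennreal (2 powr (real CARD('n) - \<alpha>) * (real CARD('n) - \<alpha>)) *
        layer_potential \<alpha> (\<lambda>y. norm (f y)) x"
proof -
  let ?n = "real CARD('n)" and ?u = "\<lambda>y. norm (f y)"
  note borel_measurable_norm_lebesgue [measurable]
  have "{y :: real ^ 'n. norm y < norm x} = ball 0 (norm x)" by auto
  then have [measurable]: "{y :: real ^ 'n. norm y < norm x} \<in> sets lebesgue" by simp
  have "ennreal (norm x powr (\<alpha> - ?n)) *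
      (\<integral>\<^sup>+ y. ennreal (norm (indicat_real {y. norm y < norm x} y *\<^sub>R f y)) \<partial>lebesgue) =
      (\<integral>\<^sup>+ y. ennreal (norm x powr (\<alpha> - ?n)) * ennreal (norm (indicat_real {y. norm y < norm x} y
          *\<^sub>R f y)) \<partial>lebesgue)"
    by (intro nn_integral_cmult[symmetric]) measurable
  also have "\<dots> = (\<integral>\<^sup>+ y. ennreal (2 powr (?n - \<alpha>)) *
      ennreal (if norm y < norm x then ?u y * (2 * norm x) powr (\<alpha> - ?n) else 0) \<partial>lebesgue)"
  proof (intro nn_integral_cong)
    fix y :: "real ^ 'n"
    have "0 < norm x" if "norm y < norm x" using that norm_ge_zero[of y] by linarith
    then show "ennreal (norm x powr (\<alpha> - ?n)) * ennreal (norm (indicat_real {y. norm y < norm x} y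
        *\<^sub>R f y)) =
      ennreal (2 powr (?n - \<alpha>)) * ennreal (if norm y < norm x then ?u y * (2 *
          norm x) powr (\<alpha> - ?n) else 0)"
      using powr_double[of "norm x" "\<alpha> - ?n"]
      by (auto simp: indicator_def ennreal_mult'[symmetric] mult.left_commute mult.commute[of _ "?u
          y"])
  qed
  also have "\<dots> = ennreal (2 powr (?n - \<alpha>)) * (\<integral>\<^sup>+ y.
      ennreal (if norm y < norm x then ?u y * (2 * norm x) powr (\<alpha> - ?n) else 0) \<partial>lebesgue)"
    by (intro nn_integral_cmult) measurable
  also have "(\<integral>\<^sup>+ y. ennreal (if norm y < norm x then ?u y * (2 *
      norm x) powr (\<alpha> - ?n) else 0) \<partial>lebesgue) \<le>
      ennreal (real DIM(real ^ 'n) - \<alpha>) * layer_potential \<alpha> ?u x"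
  proof (intro nn_integral_le_layer_potential measurable_norm_fun fm)
    fix y :: "real ^ 'n"
    have "0 < 2 * norm x" "dist x y \<le> 2 * norm x" if "norm y < norm x"
      using that norm_ge_zero[of y] norm_triangle_ineq4[of x y] by (auto simp: dist_norm)
    then show "(if norm y < norm x then ?u y * (2 * norm x) powr (\<alpha> - ?n) else 0) \<le> 0 \<or>
        (\<exists>s>0. dist x y \<le> s \<and> (if norm y < norm x then ?u y * (2 * norm x) powr (\<alpha> - ?n) else 0)
          \<le> ?u y * s powr (\<alpha> - real DIM(real ^ 'n)))"
      by (cases "norm y < norm x") (auto intro!: exI[of _ "2 * norm x"])
  qed (use \<alpha> in auto)
  finally show ?thesis
    by (simp add: ennreal_mult' mult.assoc mult_left_mono)
qed

lemma hardy_inner_bounded: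
  fixes f :: "real ^ 'n \<Rightarrow> 'b::{real_normed_field, banach, second_countable_topology}"
  assumes fm[measurable]: "f \<in> borel_measurable lebesgue" and \<alpha>: "\<alpha> < real CARD('n)"
  shows "hardy_inner \<alpha> f \<in> borel_measurable lebesgue"
    and "ennreal (norm (hardy_inner \<alpha> f x)) \<le>
      ennreal (2 powr (real CARD('n) - \<alpha>) * (real CARD('n) - \<alpha>)) *
          layer_potential \<alpha> (\<lambda>y. norm (f y)) x"
    and "x \<noteq> 0 \<Longrightarrow> layer_potential \<alpha> (\<lambda>y. norm (f y)) x < \<infinity> \<Longrightarrow> hardy_inner_defined \<alpha> f x"
proof -
  let ?I = "\<integral>\<^sup>+ y. ennreal (norm (indicat_real {y. norm y < norm x} y *\<^sub>R f y)) \<partial>lebesgue"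
  note borel_measurable_norm_lebesgue [measurable]
  show "hardy_inner \<alpha> f \<in> borel_measurable lebesgue"
    unfolding hardy_inner_def[abs_def] set_lebesgue_integral_def by measurable
  have "ennreal (norm (hardy_inner \<alpha> f x)) =
      ennreal (norm x powr (\<alpha> - real CARD('n))) * ennreal (norm (LINT y:{y. norm y < norm
          x}|lebesgue. f y))"
    by (simp add: hardy_inner_def ennreal_mult')
  also have "\<dots> \<le> ennreal (norm x powr (\<alpha> - real CARD('n))) * ?I"
    unfolding set_lebesgue_integral_def by (intro mult_left_mono norm_integral_le_nn_integral) auto
  also note hardy_inner_nn_integral_le[OF assms]
  finally show "ennreal (norm (hardy_inner \<alpha> f x)) \<le>
      ennreal (2 powr (real CARD('n) - \<alpha>) * (real CARD('n) - \<alpha>)) *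
          layer_potential \<alpha> (\<lambda>y. norm (f y)) x" .
  assume x: "x \<noteq> 0" and fin: "layer_potential \<alpha> (\<lambda>y. norm (f y)) x < \<infinity>"
  have "ennreal (norm x powr (\<alpha> - real CARD('n))) * ?I < \<infinity>"
    by (rule le_less_trans[OF hardy_inner_nn_integral_le[OF assms]])
        (use fin in \<open>simp add: ennreal_mult_less_top\<close>)
  \<comment> \<open>The prefactor is nonzero for \<open>x \<noteq> 0\<close>, so finiteness of the
    product passes to the integral.\<close>
  then have "?I < \<infinity>"
    using x by (auto simp: ennreal_mult_less_top)
  then show "hardy_inner_defined \<alpha> f x"
    unfolding hardy_inner_defined_def set_integrable_def by (intro integrableI_bounded) measurable
qed

text \<open>On \<open>norm x < norm y\<close>, positivity of \<open>\<alpha>\<close> allows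
  \<open>norm x powr \<alpha>\<close> to be replaced by \<open>norm y powr \<alpha>\<close>, which
  leaves \<open>norm y powr (\<alpha> - n)\<close>. As \<open>dist x y \<le> 2 * norm y\<close>, the
  comparison radius is \<open>2 * norm y\<close>.\<close>

lemma hardy_outer_nn_integral_le:
  fixes f :: "real ^ 'n \<Rightarrow> 'b::{real_normed_field, banach, second_countable_topology}"
  assumes fm[measurable]: "f \<in> borel_measurable lebesgue" and \<alpha>: "0 < \<alpha>" "\<alpha> < real CARD('n)"
  shows "ennreal (norm x powr \<alpha>) *
      (\<integral>\<^sup>+ y. ennreal (norm (indicat_real {y. norm y > norm x} y *\<^sub>R (f y /\<^sub>R norm y ^ CARD('n))))
          \<partial>lebesgue) \<le>
    ennreal (2 powr (real CARD('n) - \<alpha>) * (real CARD('n) - \<alpha>)) *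
        layer_potential \<alpha> (\<lambda>y. norm (f y)) x"
proof -
  let ?n = "real CARD('n)" and ?u = "\<lambda>y. norm (f y)"
  note borel_measurable_norm_lebesgue [measurable]
  have "{y :: real ^ 'n. norm x < norm y} = - cball 0 (norm x)" by auto
  then have [measurable]: "{y :: real ^ 'n. norm x < norm y} \<in> sets lebesgue" by simp
  have "ennreal (norm x powr \<alpha>) *
      (\<integral>\<^sup>+ y. ennreal (norm (indicat_real {y. norm y > norm x} y *\<^sub>R (f y /\<^sub>R norm y ^ CARD('n))))
          \<partial>lebesgue) =
      (\<integral>\<^sup>+ y. ennreal (norm x powr \<alpha>) * ennreal (norm (indicat_real {y. norm y > norm x} y *\<^sub>R (f y
          /\<^sub>R norm y ^ CARD('n)))) \<partial>lebesgue)"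
    by (intro nn_integral_cmult[symmetric]) measurable
  also have "\<dots> \<le> (\<integral>\<^sup>+ y. ennreal (2 powr (?n - \<alpha>)) *
      ennreal (if norm x < norm y then ?u y * (2 * norm y) powr (\<alpha> - ?n) else 0) \<partial>lebesgue)"
  proof (intro nn_integral_mono)
    fix y :: "real ^ 'n"
    show "ennreal (norm x powr \<alpha>) * ennreal (norm (indicat_real {y. norm y > norm x} y *\<^sub>R (f y /\<^sub>R
        norm y ^ CARD('n)))) \<le>
      ennreal (2 powr (?n - \<alpha>)) * ennreal (if norm x < norm y then ?u y * (2 *
          norm y) powr (\<alpha> - ?n) else 0)"
    proof (cases "norm x < norm y")
      case True
      then have y: "0 < norm y" using norm_ge_zero[of x] by linarith
      have "norm x powr \<alpha> * (?u y / norm y ^ CARD('n)) \<le> norm y powr \<alpha> * (?u y / norm y ^ CARD('n))"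
        using True \<alpha> by (intro mult_right_mono powr_mono2) auto
      also have "\<dots> = ?u y * norm y powr (\<alpha> - ?n)"
        using y by (simp add: powr_diff powr_realpow)
      also have "\<dots> = 2 powr (?n - \<alpha>) * (?u y * (2 * norm y) powr (\<alpha> - ?n))"
        using powr_double[OF y, of "\<alpha> - ?n"] by (simp add: mult.left_commute)
      finally show ?thesis
        using True by (simp add: ennreal_mult'[symmetric] divide_inverse mult_ac ennreal_leI)
    qed simp
  qed
  also have "\<dots> = ennreal (2 powr (?n - \<alpha>)) * (\<integral>\<^sup>+ y.
      ennreal (if norm x < norm y then ?u y * (2 * norm y) powr (\<alpha> - ?n) else 0) \<partial>lebesgue)"
    by (intro nn_integral_cmult) measurable
  also have "\<dots> \<le> ennreal (2 powr (?n - \<alpha>)) * (ennreal (real DIM(real ^ 'n) - \<alpha>) *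
      layer_potential \<alpha> ?u x)"
  proof (intro mult_left_mono nn_integral_le_layer_potential measurable_norm_fun fm)
    fix y :: "real ^ 'n"
    have "0 < 2 * norm y" "dist x y \<le> 2 * norm y" if "norm x < norm y"
      using that norm_ge_zero[of x] norm_triangle_ineq4[of x y] by (auto simp: dist_norm)
    then show "(if norm x < norm y then ?u y * (2 * norm y) powr (\<alpha> - ?n) else 0) \<le> 0 \<or>
        (\<exists>s>0. dist x y \<le> s \<and> (if norm x < norm y then ?u y * (2 * norm y) powr (\<alpha> - ?n) else 0)
          \<le> ?u y * s powr (\<alpha> - real DIM(real ^ 'n)))"
      by (cases "norm x < norm y") (auto intro!: exI[of _ "2 * norm y"])
  qed (use \<alpha> in auto)
  finally show ?thesis
    by (simp add: ennreal_mult' mult.assoc)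
qed

lemma hardy_outer_bounded:
  fixes f :: "real ^ 'n \<Rightarrow> 'b::{real_normed_field, banach, second_countable_topology}"
  assumes fm[measurable]: "f \<in> borel_measurable lebesgue" and \<alpha>: "0 < \<alpha>" "\<alpha> < real CARD('n)"
  shows "hardy_outer \<alpha> f \<in> borel_measurable lebesgue"
    and "ennreal (norm (hardy_outer \<alpha> f x)) \<le>
      ennreal (2 powr (real CARD('n) - \<alpha>) * (real CARD('n) - \<alpha>)) *
          layer_potential \<alpha> (\<lambda>y. norm (f y)) x"
    and "x \<noteq> 0 \<Longrightarrow> layer_potential \<alpha> (\<lambda>y. norm (f y)) x < \<infinity> \<Longrightarrow> hardy_outer_defined \<alpha> f x"
proof -
  let ?I = "\<integral>\<^sup>+ y. ennreal (norm (indicat_real {y. norm y > norm x} y *\<^sub>R (f y /\<^sub>R norm y ^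
      CARD('n)))) \<partial>lebesgue"
  note borel_measurable_norm_lebesgue [measurable]
  show "hardy_outer \<alpha> f \<in> borel_measurable lebesgue"
    unfolding hardy_outer_def[abs_def] set_lebesgue_integral_def by measurable
  have "ennreal (norm (hardy_outer \<alpha> f x)) =
      ennreal (norm x powr \<alpha>) * ennreal (norm (LINT y:{y. norm y > norm x}|lebesgue. f y /\<^sub>R norm y
          ^ CARD('n)))"
    by (simp add: hardy_outer_def ennreal_mult')
  also have "\<dots> \<le> ennreal (norm x powr \<alpha>) * ?I"
    unfolding set_lebesgue_integral_def by (intro mult_left_mono norm_integral_le_nn_integral) auto
  also note hardy_outer_nn_integral_le[OF assms]
  finally show "ennreal (norm (hardy_outer \<alpha> f x)) \<le>
      ennreal (2 powr (real CARD('n) - \<alpha>) * (real CARD('n) - \<alpha>)) *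
          layer_potential \<alpha> (\<lambda>y. norm (f y)) x" .
  assume x: "x \<noteq> 0" and fin: "layer_potential \<alpha> (\<lambda>y. norm (f y)) x < \<infinity>"
  have "ennreal (norm x powr \<alpha>) * ?I < \<infinity>"
    by (rule le_less_trans[OF hardy_outer_nn_integral_le[OF assms]])
        (use fin in \<open>simp add: ennreal_mult_less_top\<close>)
  then have "?I < \<infinity>"
    using x by (auto simp: ennreal_mult_less_top)
  then show "hardy_outer_defined \<alpha> f x"
    unfolding hardy_outer_defined_def set_integrable_def by (intro integrableI_bounded) measurable
qed

theorem corollary3p10:
  fixes \<alpha> l p q :: real
    and T :: "(real ^ 'n \<Rightarrow> 'b::{real_normed_field, banach, second_countable_topology}) \<Rightarrow> real ^ 'n \<Rightarrow> 'b"
    and T_defined :: "(real ^ 'n \<Rightarrow> 'b) \<Rightarrow> real ^ 'n \<Rightarrow> bool"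
  assumes "0 < \<alpha>" and "\<alpha> < real CARD('n)"
    and "0 \<le> l" and "l < real CARD('n)"
    and "1 < p" and "p < (real CARD('n) - l) / \<alpha>"
    and "1 / q = 1 / p - \<alpha> / (real CARD('n) - l)"
    and "(T, T_defined) \<in>
      {(riesz_potential \<alpha>, riesz_potential_defined \<alpha>),
       (frac_maximal \<alpha>, frac_maximal_defined \<alpha>),
       (hardy_inner \<alpha>, hardy_inner_defined \<alpha>),
       (hardy_outer \<alpha>, hardy_outer_defined \<alpha>)}"
  shows "(\<forall>f \<in> vanishing_morrey_space p l.
            (AE x in lebesgue. T_defined f x) \<and> T f \<in> vanishing_morrey_space q l) \<and>
         (\<exists>C. \<forall>f \<in> vanishing_morrey_space p l. morrey_norm q l (T f) \<le> C * morrey_norm p l f)"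
proof -
  note \<alpha> = assms(1,2)
  note bounded = dominated_operator_bounded[OF assms(1,4-7)]
  have n\<alpha>: "0 < real CARD('n) - \<alpha>" using \<alpha> by simp
  have c1: "0 < unit_ball_vol (real CARD('n)) powr (\<alpha> / real CARD('n) - 1) * (real CARD('n) - \<alpha>)"
    using n\<alpha> unit_ball_vol_pos[of "real CARD('n)"] by (intro mult_pos_pos) (auto simp: less_le)
  have c2: "0 < 2 powr (real CARD('n) - \<alpha>) * (real CARD('n) - \<alpha>)" using n\<alpha> by simp
  consider "T = riesz_potential \<alpha>" "T_defined = riesz_potential_defined \<alpha>"
    | "T = frac_maximal \<alpha>" "T_defined = frac_maximal_defined \<alpha>"
    | "T = hardy_inner \<alpha>" "T_defined = hardy_inner_defined \<alpha>"
    | "T = hardy_outer \<alpha>" "T_defined = hardy_outer_defined \<alpha>"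
    using assms(8) by auto
  then show ?thesis
  proof cases
    case 1
    show ?thesis unfolding 1
      by (rule bounded[OF n\<alpha>]) (rule riesz_potential_bounded[OF _ \<alpha>(2)]; assumption)+
  next
    case 2
    show ?thesis unfolding 2
      by (rule bounded[OF c1]) (rule frac_maximal_bounded[OF _ \<alpha>(2)]; assumption)+
  next
    case 3
    show ?thesis unfolding 3
      by (rule bounded[OF c2]) (rule hardy_inner_bounded[OF _ \<alpha>(2)]; assumption)+
  next
    case 4
    show ?thesis unfolding 4
      by (rule bounded[OF c2]) (rule hardy_outer_bounded[OF _ \<alpha>]; assumption)+
  qed
qed

end
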